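(* Let $H$ be a hyperplane in $\mathbb{R}^n$ and let $1\le p<\infty$. Then the Solynin rearrangement $So_H$ with respect to $H$ is approximable in $L^p$ on $L^p_+(\mathbb{R}^n)$ by finite compositions of polarizations, and hence the associated Solynin set map is approximable on $\mathcal{L}^n$ by finite compositions of polarizations.
   Context: $\mathcal{L}^n$ is the class of Lebesgue ($\mathcal H^n$-)measurable subsets of $\mathbb{R}^n$ of finite measure; $L^p_+(\mathbb{R}^n)$ is the set of nonnegative functions in $L^p(\mathbb{R}^n)$. For an oriented hyperplane $H$ with closed halfspaces $H^+,H^-$ and reflection $x\mapsto x^\dagger$ in $H$, the polarization of a function is $P_Hf(x)=\max\{f(x),f(x^\dagger)\}$ for $x\in H^+$ and $\min\{f(x),f(x^\dagger)\}$ for $x\in H^-$; on sets, $(P_HA)\cap H^+=(A\cup A^\dagger)\cap H^+$ and $(P_HA)\cap H^-=(A\cap A^\dagger)\cap H^-$. The Solynin set map with respect to an oriented hyperplane $H$ acts separately on each line orthogonal to $H$; identifying such a line with $\mathbb{R}$ (oriented by the orientation of $H$) so that $H$ corresponds to the point $t$, it maps a measurable $A\subset\mathbb{R}$ of finite measure to $[t-r_A,t+r_A]\cup(A\cap[t,\infty))$, where $r_A\ge0$ is chosen so the measure is preserved. The Solynin rearrangement $So_H$ is the rearrangement of nonnegative functions vanishing at infinity whose superlevel sets $\{So_Hf>s\}$ are the images of $\{f>s\}$ under this set map. A map $T$ is approximable in $L^p$ on a class $X$ by maps in a family $\mathcal W$ if there are $T_k\in\mathcal W$ with $\|T_kf-Tf\|_p\to0$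 for every $f\in X$; a set map $\diamond$ is approximable on $\mathcal E$ by maps in $\mathcal G$ if there are $\diamond_k\in\mathcal G$ with $\|1_{\diamond_kA}-1_{\diamond A}\|_1\to0$ for every $A\in\mathcal E$. The polarizations in the compositions may be taken with respect to arbitrary oriented hyperplanes. *)

theory Defs
  imports "HOL-Analysis.Analysis"
begin

text \<open>An oriented hyperplane in a Euclidean space is represented by a pair (u, c) with
  u nonzero: H = {x. x \<bullet> u = c}, closed halfspaces H+ = {x. x \<bullet> u \<ge> c},
  H- = {x. x \<bullet> u \<le> c}.\<close>

definition hyp_reflect :: "('a::euclidean_space \<times> real) \<Rightarrow> 'a \<Rightarrow> 'a" where
  "hyp_reflect H x = x - (2 * (x \<bullet> fst H - snd H) / (fst H \<bullet> fst H)) *\<^sub>R fst H"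

definition polar_fun :: "('a::euclidean_space \<times> real) \<Rightarrow> ('a \<Rightarrow> real) \<Rightarrow> 'a \<Rightarrow> real" where
  "polar_fun H f x =
     (if x \<bullet> fst H \<ge> snd H then max (f x) (f (hyp_reflect H x))
      else min (f x) (f (hyp_reflect H x)))"

definition polar_set :: "('a::euclidean_space \<times> real) \<Rightarrow> 'a set \<Rightarrow> 'a set" where
  "polar_set H A =
     {x. (x \<bullet> fst H \<ge> snd H \<and> (x \<in> A \<or> hyp_reflect H x \<in> A))
       \<or> (x \<bullet> fst H \<le> snd H \<and> x \<in> A \<and> hyp_reflect H x \<in> A)}"

definition polar_comp_fun :: "('a::euclidean_space \<times> real) list \<Rightarrow> ('a \<Rightarrow> real) \<Rightarrow> 'a \<Rightarrow> real" where
  "polar_comp_fun Hs = foldr (\<lambda>H T. polar_fun H \<circ> T) Hs id"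

definition polar_comp_set :: "('a::euclidean_space \<times> real) list \<Rightarrow> 'a set \<Rightarrow> 'a set" where
  "polar_comp_set Hs = foldr (\<lambda>H T. polar_set H \<circ> T) Hs id"

definition solynin1 :: "real \<Rightarrow> real set \<Rightarrow> real set" where
  "solynin1 t S =
     (let r = (SOME r. r \<ge> 0 \<and>
                 emeasure lebesgue ({t - r..t + r} \<union> (S \<inter> {t..})) = emeasure lebesgue S)
      in {t - r..t + r} \<union> (S \<inter> {t..}))"

text \<open>Solynin set map in R^n w.r.t. the oriented hyperplane H = (u, c): acts on each line
  orthogonal to H, parametrized by s \<mapsto> y + s e with e = u / |u| (so H corresponds to
  s = c / |u| and the positive direction is the orientation of H).\<close>
definition solynin_set :: "('a::euclidean_space \<times> real) \<Rightarrow> 'a set \<Rightarrow> 'a set" where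
  "solynin_set H A =
     {x. let e = (1 / norm (fst H)) *\<^sub>R fst H; s = x \<bullet> e; y = x - s *\<^sub>R e
         in s \<in> solynin1 (snd H / norm (fst H)) {s'. y + s' *\<^sub>R e \<in> A}}"

text \<open>Solynin rearrangement of a nonnegative function: the function whose superlevel sets
  {g > s}, s > 0, are (up to null sets) the images of {f > s} under the set map.\<close>
definition solynin_fun :: "('a::euclidean_space \<times> real) \<Rightarrow> ('a \<Rightarrow> real) \<Rightarrow> 'a \<Rightarrow> real" where
  "solynin_fun H f x = Sup ({0} \<union> {s. s > 0 \<and> x \<in> solynin_set H {y. f y > s}})"

definition Lp_norm :: "real \<Rightarrow> ('a::euclidean_space \<Rightarrow> real) \<Rightarrow> ennreal" where
  "Lp_norm p g =
     (let I = (\<integral>\<^sup>+ x. ennreal (\<bar>g x\<bar> powr p) \<partial>lebesgue)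
      in if I = \<infinity> then \<infinity> else ennreal (enn2real I powr (1 / p)))"

definition Lp_plus :: "real \<Rightarrow> ('a::euclidean_space \<Rightarrow> real) set" where
  "Lp_plus p = {f. f \<in> borel_measurable lebesgue \<and> (\<forall>x. f x \<ge> 0) \<and>
                   (\<integral>\<^sup>+ x. ennreal (\<bar>f x\<bar> powr p) \<partial>lebesgue) < \<infinity>}"

end

theory Submission
  imports Defs
begin

text \<open>On a line, So with respect to b pushes all the mass of A to the left of some point m into an
  interval ending at m and centred at b. Moving b from far left to t in small steps, a single polarization
  at the midpoint of two consecutive centres b, b' imitates the step from one of these sets to the
  next, up to twice the smaller of the mass of A and of its complement in the window (m, m']. These errors
  add up because polarizations contract the symmetric difference, and their sum tends to 0 with the step
  since A lies between a compact and an open set of nearly the same measure. The polarizations do not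
  depend on A, so a layer cake argument, with |a - b|^p \<le> |a^p - b^p|, transfers the convergence to
  functions; dominated convergence over the lines orthogonal to H does the rest.\<close>

section \<open>Polarizations of the line\<close>

text \<open>The sweep has \<open>k * k\<close> steps of length \<open>1 / k\<close>, so an error of
  the order of the step at every stage would add up to the swept length, which is unbounded. What
  saves the argument is that both extreme kinds of window are free. If the window holds no mass,
  centre and endpoint move by the same amount and the midpoint reflection carries the old interval
  onto the new one. If it is full, the interval only grows at its right end into points that were
  already there: up to null sets the two sets coincide, and the polarization leaves them alone. Only
  windows containing much of both \<open>A\<close> and its complement cost anything, and at small
  scales these are rare. Sets are parametrised by the right endpoint \<open>m\<close> rather than by
  the centre \<open>b\<close>. The balance \<open>2 * m - 2 * b = mass A m\<close> then reduces the
  geometry to linear arithmetic in two numbers, the mass absorbed in a window and the gap left in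
  it. On the hyperplane itself every image of a level set contains the point, so the supremum
  defining the rearrangement may be over an unbounded set there. Pointwise comparisons are therefore
  made off the hyperplane only.\<close>

lemma hyp_reflect_real: "hyp_reflect (1, b) (x::real) = 2 * b - x"
  by (simp add: hyp_reflect_def algebra_simps)

lemma mem_polar_set_real:
  "(x::real) \<in> polar_set (1, b) A \<longleftrightarrow>
     (b \<le> x \<and> (x \<in> A \<or> 2 * b - x \<in> A)) \<or> (x \<le> b \<and> x \<in> A \<and> 2 * b - x \<in> A)"
  by (simp add: polar_set_def hyp_reflect_real)

lemma measurable_reflect_lebesgue: "(\<lambda>x::real. t - x) \<in> lebesgue \<rightarrow>\<^sub>M lebesgue"
  using lebesgue_affine_measurable[of "\<lambda>_. -1" t] by simp

lemma sets_reflect_lebesgue: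
  assumes "A \<in> sets lebesgue"
  shows "{x::real. t - x \<in> A} \<in> sets lebesgue"
  using measurable_sets[OF measurable_reflect_lebesgue assms, of t] by (simp add: vimage_def)

lemma emeasure_reflect_lebesgue:
  fixes A :: "real set"
  assumes [measurable]: "A \<in> sets lebesgue"
  shows "emeasure lebesgue {x. t - x \<in> A} = emeasure lebesgue A"
proof -
  have "emeasure lebesgue A = (\<integral>\<^sup>+x. indicator A x \<partial>lebesgue)" by simp
  also have "\<dots> = ennreal \<bar>-1\<bar> * (\<integral>\<^sup>+x. indicator A (t + (-1) * x) \<partial>lebesgue)"
    by (rule nn_integral_real_affine_lebesgue) auto
  also have "\<dots> = (\<integral>\<^sup>+x. indicator {x. t - x \<in> A} x \<partial>lebesgue)"
    by (simp add: indicator_def)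
  also have "\<dots> = emeasure lebesgue {x. t - x \<in> A}"
    using sets_reflect_lebesgue[OF assms] by simp
  finally show ?thesis by simp
qed

lemma sets_polar_set_real:
  fixes A :: "real set"
  assumes "A \<in> sets lebesgue"
  shows "polar_set (1::real, b) A \<in> sets lebesgue"
proof -
  have "polar_set (1, b) A = ({b..} \<inter> (A \<union> {x. 2 * b - x \<in> A})) \<union> ({..b} \<inter> A \<inter> {x. 2 * b - x \<in> A})"
    by (auto simp: mem_polar_set_real)
  then show ?thesis using assms sets_reflect_lebesgue[OF assms, of "2*b"]
    by (auto intro!: sets.Un sets.Int)
qed

text \<open>Points are grouped with their mirror images. Within a pair, polarization only sorts the
  memberships towards the right, and sorting two pairs of truth values cannot increase the number of
  places where they disagree. Adding the mirrored symmetric difference counts every pair twice,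
  whence the factor 2 that is cancelled at the end.\<close>

lemma emeasure_sym_diff_polar_set_real:
  fixes X Y :: "real set"
  assumes X: "X \<in> sets lebesgue" and Y: "Y \<in> sets lebesgue"
  shows "emeasure lebesgue (sym_diff (polar_set (1::real, b) X) (polar_set (1, b) Y))
          \<le> emeasure lebesgue (sym_diff X Y)" (is "emeasure lebesgue ?P \<le> emeasure lebesgue ?D")
proof -
  define R where "R S = {x::real. 2 * b - x \<in> S}" for S
  have D: "?D \<in> sets lebesgue" and P: "?P \<in> sets lebesgue"
    using X Y by (auto intro: sets_polar_set_real)
  have RS: "R S \<in> sets lebesgue" "emeasure lebesgue (R S) = emeasure lebesgue S"
    if "S \<in> sets lebesgue" for S
    using that sets_reflect_lebesgue emeasure_reflect_lebesgue by (auto simp: R_def)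
  have "2 * emeasure lebesgue ?P = emeasure lebesgue ?P + emeasure lebesgue (R ?P)"
    using RS(2)[OF P] by (simp add: mult_2)
  also have "\<dots> = (\<integral>\<^sup>+x. indicator ?P x + indicator (R ?P) x \<partial>lebesgue)"
    using P RS(1)[OF P] by (subst nn_integral_add) auto
  also have "\<dots> \<le> (\<integral>\<^sup>+x. indicator ?D x + indicator (R ?D) x \<partial>lebesgue)"
  proof (rule nn_integral_mono)
    fix x
    show "(indicator ?P x + indicator (R ?P) x :: ennreal) \<le> indicator ?D x + indicator (R ?D) x"
    proof (cases "x = b")
      case True
      have e: "2 * b - b = b" by simp
      show ?thesis using True by (auto simp: R_def mem_polar_set_real indicator_def e)
    next
      case False
      then have "x < b \<and> \<not> b \<le> x \<and> b \<le> 2 * b - x \<and> \<not> 2 * b - x \<le> b \<or>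
                 b < x \<and> \<not> x \<le> b \<and> 2 * b - x \<le> b \<and> \<not> b \<le> 2 * b - x" by auto
      then show ?thesis
        by (cases "x \<in> X"; cases "x \<in> Y"; cases "2 * b - x \<in> X"; cases "2 * b - x \<in> Y")
           (auto simp: R_def mem_polar_set_real indicator_def)
    qed
  qed
  also have "\<dots> = emeasure lebesgue ?D + emeasure lebesgue (R ?D)"
    using D RS(1)[OF D] by (subst nn_integral_add) auto
  also have "\<dots> = 2 * emeasure lebesgue ?D"
    using RS(2)[OF D] by (simp add: mult_2)
  finally show ?thesis
    by (simp add: ennreal_mult_le_mult_iff)
qed

lemma emeasure_polar_set_real_le:
  assumes "X \<in> sets lebesgue"
  shows "emeasure lebesgue (polar_set (1::real, b) X) \<le> emeasure lebesgue X"
proof -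
  have "polar_set (1, b) {} = ({} :: real set)" by (auto simp: polar_set_def)
  then show ?thesis using emeasure_sym_diff_polar_set_real[of X "{}" b] assms by simp
qed

lemma lmeasurable_polar_set_real:
  assumes "X \<in> lmeasurable"
  shows "polar_set (1::real, b) X \<in> lmeasurable"
  using assms emeasure_polar_set_real_le[of X b] sets_polar_set_real[of X b]
  by (auto simp: fmeasurable_def intro: le_less_trans)

text \<open>Meaningful for sets of finite measure only, since \<open>measure\<close> takes the value
  0 on sets of infinite measure; hence the \<open>lmeasurable\<close> hypotheses below.\<close>

definition leb_dist :: "real set \<Rightarrow> real set \<Rightarrow> real" where
  "leb_dist X Y = measure lebesgue (sym_diff X Y)"

lemma leb_dist_triangle:
  assumes "X \<in> lmeasurable" "Y \<in> lmeasurable" "Z \<in> lmeasurable"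
  shows "leb_dist X Z \<le> leb_dist X Y + leb_dist Y Z"
proof -
  have "leb_dist X Z \<le> measure lebesgue (sym_diff X Y \<union> sym_diff Y Z)"
    unfolding leb_dist_def by (rule measure_mono_fmeasurable) (use assms in auto)
  also have "\<dots> \<le> leb_dist X Y + leb_dist Y Z"
    unfolding leb_dist_def by (rule measure_Un_le) (use assms in auto)
  finally show ?thesis .
qed

lemma leb_dist_le:
  assumes "sym_diff X Y \<subseteq> Z" "X \<in> lmeasurable" "Y \<in> lmeasurable" "Z \<in> lmeasurable"
  shows "leb_dist X Y \<le> measure lebesgue Z"
  unfolding leb_dist_def by (rule measure_mono_fmeasurable) (use assms in auto)

lemma leb_dist_polar_set:
  assumes "X \<in> lmeasurable" "Y \<in> lmeasurable"
  shows "leb_dist (polar_set (1, b) X) (polar_set (1, b) Y) \<le> leb_dist X Y"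
proof -
  have *: "sym_diff X Y \<in> lmeasurable" using assms by auto
  show ?thesis
    unfolding leb_dist_def measure_def
    using emeasure_sym_diff_polar_set_real[of X Y b] assms fmeasurableD2[OF *]
    by (intro enn2real_mono) (auto simp: top.not_eq_extremum fmeasurableD)
qed

section \<open>Pushing mass to the right\<close>

definition mass :: "real set \<Rightarrow> real \<Rightarrow> real" where
  "mass A m = measure lebesgue (A \<inter> {..m})"

text \<open>The image under the Solynin map, written in terms of its right endpoint: no radius has
  to be chosen, and the centre is \<open>m - mass A m / 2\<close>.\<close>

definition push :: "real set \<Rightarrow> real \<Rightarrow> real set" where
  "push A m = {m - mass A m..m} \<union> (A \<inter> {m<..})"

lemma lmeasurable_Int_borel:
  assumes "A \<in> lmeasurable" "B \<in> sets borel"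
  shows "A \<inter> B \<in> lmeasurable"
  by (rule fmeasurable_Int_fmeasurable[OF assms(1)]) (use assms in auto)

lemma lmeasurable_Ioc: "{m<..m'::real} \<in> lmeasurable"
  by (rule fmeasurableI2[of "{m..m'}"]) auto

lemma mass_nonneg: "0 \<le> mass A m"
  by (simp add: mass_def)

lemma mass_le: "A \<in> lmeasurable \<Longrightarrow> mass A m \<le> measure lebesgue A"
  unfolding mass_def by (rule measure_mono_fmeasurable) (auto simp: fmeasurableD)

lemma lmeasurable_push: "A \<in> lmeasurable \<Longrightarrow> push A m \<in> lmeasurable"
  unfolding push_def by (intro fmeasurable.Un lmeasurable_Int_borel) auto

lemma measure_Int_add_Diff_Ioc:
  assumes "A \<in> lmeasurable" "m \<le> m'"
  shows "measure lebesgue (A \<inter> {m<..m'}) + measure lebesgue ({m<..m'} - A) = m' - m"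
proof -
  have I: "{m<..m'} \<in> lmeasurable" by (rule lmeasurable_Ioc)
  have "measure lebesgue {m<..m'} = m' - m"
    using assms by (simp add: measure_def)
  moreover have "measure lebesgue {m<..m'} = measure lebesgue ({m<..m'} \<inter> A) + measure lebesgue ({m<..m'} - A)"
  proof -
    have "{m<..m'} \<inter> A \<union> ({m<..m'} - A) = {m<..m'}" "({m<..m'} - A) - ({m<..m'} \<inter> A) = {m<..m'} - A"
      by auto
    moreover have "{m<..m'} \<inter> A \<in> lmeasurable" "{m<..m'} - A \<in> lmeasurable"
      using I assms by (auto simp: fmeasurableD intro: fmeasurable_Diff)
    ultimately show ?thesis
      using measure_Un2[of "{m<..m'} \<inter> A" lebesgue "{m<..m'} - A"] by simp
  qed
  ultimately show ?thesis by (simp add: Int_commute)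
qed

lemma mass_add:
  assumes "A \<in> lmeasurable" "m \<le> m'"
  shows "mass A m' = mass A m + measure lebesgue (A \<inter> {m<..m'})"
proof -
  have "A \<inter> {..m'} = (A \<inter> {..m}) \<union> (A \<inter> {m<..m'})"
    "A \<inter> {m<..m'} - A \<inter> {..m} = A \<inter> {m<..m'}" using assms by auto
  moreover have "A \<inter> {..m} \<in> lmeasurable" "A \<inter> {m<..m'} \<in> lmeasurable"
    using assms by (auto intro: lmeasurable_Int_borel)
  ultimately show ?thesis unfolding mass_def
    using measure_Un2[of "A \<inter> {..m}" lebesgue "A \<inter> {m<..m'}"] by simp
qed

text \<open>Start of the sweep: nothing changes beyond \<open>m\<close>, and to its left the old
  mass is replaced by an interval of the same length.\<close>

lemma leb_dist_push_le:
  assumes A: "A \<in> lmeasurable"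
  shows "leb_dist A (push A m) \<le> 2 * mass A m"
proof -
  have "leb_dist A (push A m) \<le> measure lebesgue ((A \<inter> {..m}) \<union> {m - mass A m..m})"
  proof (rule leb_dist_le)
    show "sym_diff A (push A m) \<subseteq> A \<inter> {..m} \<union> {m - mass A m..m}" by (auto simp: push_def)
    show "A \<inter> {..m} \<union> {m - mass A m..m} \<in> lmeasurable"
      using A by (intro fmeasurable.Un lmeasurable_Int_borel) auto
  qed (use A lmeasurable_push in auto)
  also have "\<dots> \<le> measure lebesgue (A \<inter> {..m}) + measure lebesgue {m - mass A m..m}"
    by (rule measure_Un_le) (use A in auto)
  also have "\<dots> = 2 * mass A m" using mass_nonneg[of A m] by (simp add: mass_def)
  finally show ?thesis .
qed

text \<open>The hyperplane halfway between the centres of two sets of the form \<^const>\<open>push\<close> maps the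
  left interval of the first one exactly onto that of the second one when no mass is absorbed in
  between, which is why the error is controlled by the absorbed mass as well as by the gaps.\<close>

lemma leb_dist_polar_push_le:
  assumes A: "A \<in> lmeasurable" and m: "m \<le> m'"
    and b: "2 * m - 2 * b = mass A m" and b': "2 * m' - 2 * b' = mass A m'"
  shows "leb_dist (polar_set (1, (b + b') / 2) (push A m)) (push A m')
           \<le> 2 * min (measure lebesgue (A \<inter> {m<..m'})) (measure lebesgue ({m<..m'} - A))"
proof -
  define a where "a = measure lebesgue (A \<inter> {m<..m'})"
  define g where "g = measure lebesgue ({m<..m'} - A)"
  define F where "F = mass A m"
  define \<beta> where "\<beta> = (b + b') / 2"
  have a0: "0 \<le> a" and g0: "0 \<le> g" and F0: "0 \<le> F" by (simp_all add: a_def g_def F_def mass_nonneg)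
  have ag: "a + g = m' - m" using measure_Int_add_Diff_Ioc[OF A m] by (simp add: a_def g_def)
  have F': "mass A m' = F + a" using mass_add[OF A m] by (simp add: a_def F_def)
  have beta: "2 * \<beta> = m + m' - F - a / 2" using b b' F' unfolding \<beta>_def F_def by (simp add: field_simps)
  have X: "push A m = {m - F..m} \<union> (A \<inter> {m<..})" by (simp add: push_def F_def)
  have Y: "push A m' = {m' - F - a..m'} \<union> (A \<inter> {m'<..})" by (simp add: push_def F' algebra_simps)
  have I: "{m<..m'} \<in> lmeasurable" by (rule lmeasurable_Ioc)
  have Xm: "push A m \<in> lmeasurable" and Ym: "push A m' \<in> lmeasurable"
    using A by (auto intro: lmeasurable_push)
  have PX: "polar_set (1, \<beta>) (push A m) \<in> lmeasurable" using Xm by (rule lmeasurable_polar_set_real)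
  \<comment> \<open>The target is fixed by the polarization: its interval is centred at
    \<open>b'\<close>, which is not left of \<open>\<beta>\<close> because
    \<open>b' - b = g + a / 2\<close>, and the rest of it lies beyond \<open>m'\<close>, hence
    beyond \<open>\<beta>\<close>.\<close>
  have PY: "polar_set (1, \<beta>) (push A m') = push A m'"
  proof (intro set_eqI iffI)
    fix x assume "x \<in> polar_set (1, \<beta>) (push A m')"
    then consider "x \<in> push A m'" | "\<beta> \<le> x" "2 * \<beta> - x \<in> push A m'"
      by (auto simp: mem_polar_set_real)
    then show "x \<in> push A m'"
    proof cases
      case 2
      then have "2 * \<beta> - x \<le> m'" using beta a0 g0 F0 ag by linarith
      then have "m' - F - a \<le> 2 * \<beta> - x" using 2 by (auto simp: Y)
      then have "x \<le> m'" "m' - F - a \<le> x" using 2 beta a0 g0 F0 ag by linarith+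
      then show ?thesis by (simp add: Y)
    qed
  next
    fix x assume x: "x \<in> push A m'"
    show "x \<in> polar_set (1, \<beta>) (push A m')"
    proof (cases "\<beta> \<le> x")
      case False
      then have "x \<le> m'" using beta a0 g0 F0 ag by linarith
      then have "m' - F - a \<le> x" using x by (auto simp: Y)
      then have "m' - F - a \<le> 2 * \<beta> - x" "2 * \<beta> - x \<le> m'" using False beta a0 g0 F0 ag by linarith+
      then have "2 * \<beta> - x \<in> push A m'" by (simp add: Y)
      then show ?thesis using False x by (simp add: mem_polar_set_real)
    qed (use x in \<open>simp add: mem_polar_set_real\<close>)
  qed
  have "leb_dist (polar_set (1, \<beta>) (push A m)) (push A m') \<le> leb_dist (push A m) (push A m')"
    using leb_dist_polar_set[OF Xm Ym, of \<beta>] by (simp add: PY)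
  \<comment> \<open>Since \<open>m' - m = a + g\<close>, the left end moves from
    \<open>m - F\<close> to \<open>m - F + g\<close>; the only other difference is the gap that gets
    filled in the window. This is the bound for a nearly full window.\<close>
  also have "\<dots> \<le> measure lebesgue ({m - F..m - F + g} \<union> ({m<..m'} - A))"
  proof (rule leb_dist_le[OF _ Xm Ym])
    show "sym_diff (push A m) (push A m') \<subseteq> {m - F..m - F + g} \<union> ({m<..m'} - A)"
      unfolding X Y using a0 g0 F0 ag m by auto
    show "{m - F..m - F + g} \<union> ({m<..m'} - A) \<in> lmeasurable"
      using A I by (intro fmeasurable.Un fmeasurable_Diff) (auto simp: fmeasurableD)
  qed
  also have "\<dots> \<le> measure lebesgue {m - F..m - F + g} + measure lebesgue ({m<..m'} - A)"
    by (rule measure_Un_le) (use A in auto)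
  also have "\<dots> = 2 * g" using g0 by (simp add: g_def)
  finally have 1: "leb_dist (polar_set (1, \<beta>) (push A m)) (push A m') \<le> 2 * g" .
  \<comment> \<open>For a nearly empty window, its mass is first deleted, at cost \<open>a\<close>.
    The reflection then carries \<open>[m - F, m]\<close> onto
    \<open>[m' - F - a / 2, m' - a / 2]\<close>, which falls short of the target interval by
    \<open>a / 2\<close> at either end, so the total is \<open>2 * a\<close>.\<close>
  define Z where "Z = {m - F..m} \<union> (A \<inter> {m'<..})"
  have Zm: "Z \<in> lmeasurable" unfolding Z_def using A by (intro fmeasurable.Un lmeasurable_Int_borel) auto
  have PZ: "polar_set (1, \<beta>) Z \<in> lmeasurable" using Zm by (rule lmeasurable_polar_set_real)
  have "leb_dist (polar_set (1, \<beta>) (push A m)) (polar_set (1, \<beta>) Z) \<le> leb_dist (push A m) Z"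
    using leb_dist_polar_set[OF Xm Zm] .
  also have "\<dots> \<le> a" unfolding a_def
  proof (rule leb_dist_le[OF _ Xm Zm])
    show "sym_diff (push A m) Z \<subseteq> A \<inter> {m<..m'}"
      unfolding X Z_def using m by auto
    show "A \<inter> {m<..m'} \<in> lmeasurable" using A by (intro lmeasurable_Int_borel) auto
  qed
  finally have 2: "leb_dist (polar_set (1, \<beta>) (push A m)) (polar_set (1, \<beta>) Z) \<le> a" .
  have "sym_diff (polar_set (1, \<beta>) Z) (push A m') \<subseteq>
          {m' - F - a..m' - F - a / 2} \<union> {m' - a / 2..m'}"
  proof (rule Un_least; rule subsetI)
    fix x assume x: "x \<in> polar_set (1, \<beta>) Z - push A m'"
    have far: "m' < x \<Longrightarrow> x \<notin> Z" and near: "x \<le> m' \<Longrightarrow> x < m' - F - a"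
      using x m by (auto simp: Y Z_def)
    have Zc: "(m - F \<le> y \<and> y \<le> m) \<or> m' < y" if "y \<in> Z" for y using that by (auto simp: Z_def)
    from x consider "\<beta> \<le> x" "x \<in> Z" | "\<beta> \<le> x" "2 * \<beta> - x \<in> Z"
      | "x \<le> \<beta>" "x \<in> Z" "2 * \<beta> - x \<in> Z"
      by (auto simp: mem_polar_set_real)
    then have False
    proof cases
      case 1 show ?thesis using Zc[OF 1(2)] far near 1 beta a0 g0 F0 ag m by linarith
    next
      case 2 show ?thesis using Zc[OF 2(2)] near 2(1) beta a0 g0 F0 ag m by linarith
    next
      case 3 show ?thesis using Zc[OF 3(2)] Zc[OF 3(3)] far near 3 beta a0 g0 F0 ag m by linarith
    qed
    then show "x \<in> {m' - F - a..m' - F - a / 2} \<union> {m' - a / 2..m'}" ..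
  next
    fix x assume x: "x \<in> push A m' - polar_set (1, \<beta>) Z"
    show "x \<in> {m' - F - a..m' - F - a / 2} \<union> {m' - a / 2..m'}"
    proof (rule ccontr)
      assume n: "\<not> ?thesis"
      have "\<beta> \<le> m'" using beta a0 g0 F0 ag by linarith
      then have "x \<le> m'" using x by (auto simp: Y Z_def mem_polar_set_real)
      then have "m' - F - a / 2 < x" "x < m' - a / 2" using x n by (auto simp: Y)
      then have "m - F \<le> 2 * \<beta> - x" "2 * \<beta> - x \<le> m" "m - F \<le> x" "x < \<beta> \<Longrightarrow> x \<le> m"
        using beta a0 g0 F0 ag m by linarith+
      then have "2 * \<beta> - x \<in> Z" "x < \<beta> \<Longrightarrow> x \<in> Z" by (auto simp: Z_def)
      then show False using x by (auto simp: mem_polar_set_real)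
    qed
  qed
  then have "leb_dist (polar_set (1, \<beta>) Z) (push A m') \<le>
      measure lebesgue ({m' - F - a..m' - F - a / 2} \<union> {m' - a / 2..m'})"
    using PZ Ym by (intro leb_dist_le) auto
  also have "\<dots> \<le> measure lebesgue {m' - F - a..m' - F - a / 2} + measure lebesgue {m' - a / 2..m'}"
    by (rule measure_Un_le) auto
  also have "\<dots> = a" using a0 by simp
  finally have 3: "leb_dist (polar_set (1, \<beta>) Z) (push A m') \<le> a" .
  show ?thesis
    using 1 2 3 leb_dist_triangle[OF PX PZ Ym] unfolding a_def g_def \<beta>_def by linarith
qed

section \<open>Sweeping by polarizations\<close>

text \<open>A closed inner approximation is cut down by large balls; continuity of the measure from
  below makes the loss small.\<close>

lemma lmeasurable_inner_compact:
  fixes A :: "'a::euclidean_space set"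
  assumes A: "A \<in> lmeasurable" and e: "0 < e"
  obtains K where "compact K" "K \<subseteq> A" "measure lebesgue (A - K) < e"
proof -
  obtain T where T: "closed T" "T \<subseteq> A" "A - T \<in> lmeasurable" "emeasure lebesgue (A - T) < ennreal (e / 2)"
    using sets_lebesgue_inner_closed[of A "e / 2"] A e by (auto simp: fmeasurableD)
  have T2: "measure lebesgue (A - T) < e / 2"
    using T e by (simp add: emeasure_eq_measure2 ennreal_less_iff)
  have Tm: "T \<in> lmeasurable"
    by (rule fmeasurableI2[OF A T(2)]) (use T(1) in auto)
  define K where "K n = T \<inter> cball 0 (real n)" for n
  have K: "compact (K n)" for n unfolding K_def using T(1) by (simp add: closed_Int_compact)
  have Km: "K n \<in> lmeasurable" for n using K by (rule lmeasurable_compact)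
  have "(\<lambda>n. measure lebesgue (K n)) \<longlonglongrightarrow> measure lebesgue (\<Union>n. K n)"
  proof (rule Lim_measure_incseq)
    show "range K \<subseteq> sets lebesgue" using Km by (auto simp: fmeasurableD)
    show "incseq K" by (auto simp: incseq_def K_def)
    have "emeasure lebesgue (\<Union>n. K n) \<le> emeasure lebesgue T"
      by (rule emeasure_mono) (use Tm in \<open>auto simp: K_def fmeasurableD\<close>)
    then show "emeasure lebesgue (\<Union>n. K n) \<noteq> \<infinity>"
      using fmeasurableD2[OF Tm] by (auto simp: top_unique)
  qed
  moreover have "(\<Union>n. K n) = T"
    by (auto simp: K_def intro: real_arch_simple)
  ultimately have "(\<lambda>n. measure lebesgue (K n)) \<longlonglongrightarrow> measure lebesgue T" by simp
  then have "\<forall>\<^sub>F n in sequentially. measure lebesgue T - e / 2 < measure lebesgue (K n)"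
    using e by (intro order_tendstoD) auto
  then obtain n where n: "measure lebesgue T - e / 2 < measure lebesgue (K n)"
    by (auto simp: eventually_sequentially)
  have sub: "K n \<subseteq> T" by (auto simp: K_def)
  have "measure lebesgue (A - K n) = measure lebesgue A - measure lebesgue (K n)"
    "measure lebesgue (A - T) = measure lebesgue A - measure lebesgue T"
    using A Km Tm sub T(2) by (auto intro!: measurable_measure_Diff simp: fmeasurableD)
  then show ?thesis using n T2 sub T(2) K[of n] by (intro that[of "K n"]) auto
qed

lemma mass_tendsto_at_bot:
  assumes A: "A \<in> lmeasurable" and e: "0 < e"
  obtains M where "\<And>m. m \<le> M \<Longrightarrow> mass A m < e"
proof -
  obtain K where K: "compact K" "K \<subseteq> A" "measure lebesgue (A - K) < e"
    using lmeasurable_inner_compact[OF A e] .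
  obtain B where B: "\<And>x. x \<in> K \<Longrightarrow> \<bar>x\<bar> \<le> B"
    using compact_imp_bounded[OF K(1)] by (auto simp: bounded_iff)
  have Km: "K \<in> lmeasurable" using K(1) by (rule lmeasurable_compact)
  show ?thesis
  proof (rule that)
    fix m assume m: "m \<le> - B - 1"
    have "mass A m \<le> measure lebesgue (A - K)"
      unfolding mass_def
    proof (rule measure_mono_fmeasurable)
      show "A \<inter> {..m} \<subseteq> A - K" using m B by fastforce
    qed (use A Km in \<open>auto simp: fmeasurableD\<close>)
    then show "mass A m < e" using K(3) by simp
  qed
qed

text \<open>Choose \<open>d\<close> as a lower bound for the distance from \<open>K\<close> to the
  complement of \<open>U\<close>. A window shorter than \<open>d\<close> cannot meet both. If it
  misses \<open>K\<close>, its part of \<open>A\<close> lies in \<open>V\<close>; if it lies in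
  \<open>U\<close>, its gap does. Either way the minimum is at most the measure of \<open>V\<close>
  in the window, and the windows are disjoint, so their number does not enter.\<close>

lemma sum_min_gaps_le:
  assumes A: "A \<in> lmeasurable" and e: "0 < e"
  obtains d where "0 < d"
    "\<And>(m::nat \<Rightarrow> real) n. mono m \<Longrightarrow> (\<And>j. m (Suc j) - m j < d) \<Longrightarrow>
      (\<Sum>j<n. min (measure lebesgue (A \<inter> {m j<..m (Suc j)})) (measure lebesgue ({m j<..m (Suc j)} - A))) < e"
proof -
  obtain K where K: "compact K" "K \<subseteq> A" "measure lebesgue (A - K) < e / 2"
    using lmeasurable_inner_compact[OF A, of "e / 2"] e by auto
  obtain U where U: "open U" "A \<subseteq> U" "U - A \<in> lmeasurable" "emeasure lebesgue (U - A) < ennreal (e / 2)"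
    using sets_lebesgue_outer_open[of A "e / 2"] A e by (auto simp: fmeasurableD)
  have UA: "measure lebesgue (U - A) < e / 2"
    using U e by (simp add: emeasure_eq_measure2 ennreal_less_iff)
  have Km: "K \<in> lmeasurable" using K(1) by (rule lmeasurable_compact)
  have AKm: "A - K \<in> lmeasurable" using A Km by auto
  define V where "V = (A - K) \<union> (U - A)"
  have Vm: "V \<in> lmeasurable" unfolding V_def using AKm U(3) by auto
  have V: "measure lebesgue V < e"
    using measure_Un_le[of "A - K" lebesgue "U - A"] AKm U(3) K(3) UA unfolding V_def
    by (simp add: fmeasurableD)
  obtain d where d: "0 < d" "\<And>x y. x \<in> K \<Longrightarrow> y \<in> - U \<Longrightarrow> d \<le> dist x y"
  proof -
    have "\<exists>\<delta>>0. \<forall>x\<in>K. \<forall>y\<in>- U. \<delta> \<le> dist x y"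
      by (rule separate_compact_closed) (use K U in auto)
    then show thesis using that by blast
  qed
  show ?thesis
  proof (rule that[OF d(1)])
    fix m :: "nat \<Rightarrow> real" and n
    assume mono: "mono m" and step: "\<And>j. m (Suc j) - m j < d"
    define W where "W j = {m j<..m (Suc j)}" for j
    have "min (measure lebesgue (A \<inter> W j)) (measure lebesgue (W j - A)) \<le> measure lebesgue (V \<inter> W j)" for j
    proof (cases "K \<inter> W j = {}")
      case True
      then have "A \<inter> W j \<subseteq> V \<inter> W j" by (auto simp: V_def)
      then have "measure lebesgue (A \<inter> W j) \<le> measure lebesgue (V \<inter> W j)"
        by (rule measure_mono_fmeasurable)
           (use A Vm in \<open>auto simp: W_def fmeasurableD intro!: lmeasurable_Int_borel\<close>)
      then show ?thesis by simp
    next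
      case False
      then obtain x where x: "x \<in> K" "x \<in> W j" by auto
      have "W j \<subseteq> U"
      proof
        fix y assume y: "y \<in> W j"
        have "dist x y < d" using x y step[of j] by (auto simp: W_def dist_real_def)
        then show "y \<in> U" using d(2)[OF x(1), of y] by auto
      qed
      then have "W j - A \<subseteq> V \<inter> W j" by (auto simp: V_def)
      then have "measure lebesgue (W j - A) \<le> measure lebesgue (V \<inter> W j)"
        by (rule measure_mono_fmeasurable)
           (use A Vm in \<open>auto simp: W_def fmeasurableD intro!: lmeasurable_Int_borel\<close>)
      then show ?thesis by simp
    qed
    then have "(\<Sum>j<n. min (measure lebesgue (A \<inter> W j)) (measure lebesgue (W j - A)))
        \<le> (\<Sum>j<n. measure lebesgue (V \<inter> W j))" by (rule sum_mono)
    also have "\<dots> = measure lebesgue (\<Union>j<n. V \<inter> W j)"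
    proof (rule measure_UNION'[symmetric])
      have "W i \<inter> W j = {}" if "i < j" for i j
      proof -
        have "m (Suc i) \<le> m j" using that mono by (simp add: monoD)
        then show ?thesis by (auto simp: W_def)
      qed
      then have "W i \<inter> W j = {}" if "i \<noteq> j" for i j
        using that by (metis Int_commute linorder_neqE_nat)
      then show "pairwise (\<lambda>i j. disjnt (V \<inter> W i) (V \<inter> W j)) {..<n}"
        by (fastforce simp: pairwise_def disjnt_def)
    qed (use Vm in \<open>auto simp: W_def intro!: lmeasurable_Int_borel\<close>)
    also have "\<dots> \<le> measure lebesgue V"
      by (rule measure_mono_fmeasurable)
         (use Vm in \<open>auto simp: W_def fmeasurableD\<close>)
    also have "\<dots> < e" by (rule V)
    finally show "(\<Sum>j<n. min (measure lebesgue (A \<inter> {m j<..m (Suc j)})) (measure lebesgue ({m j<..m (Suc j)} - A))) < e"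
      unfolding W_def .
  qed
qed

text \<open>New steps are put at the head because the head of a composition is applied last. The
  normal \<open>v\<close> is a parameter so that the same list serves on the line (\<open>1\<close>)
  and in space (a unit vector).\<close>

primrec polar_seq :: "'a \<Rightarrow> (nat \<Rightarrow> real) \<Rightarrow> nat \<Rightarrow> ('a \<times> real) list" where
  "polar_seq v b 0 = []"
| "polar_seq v b (Suc n) = (v, (b n + b (Suc n)) / 2) # polar_seq v b n"

lemma polar_comp_set_simps [simp]:
  "polar_comp_set [] A = A"
  "polar_comp_set (H # Hs) A = polar_set H (polar_comp_set Hs A)"
  by (simp_all add: polar_comp_set_def)

lemma polar_comp_fun_simps [simp]:
  "polar_comp_fun [] f = f"
  "polar_comp_fun (H # Hs) f = polar_fun H (polar_comp_fun Hs f)"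
  by (simp_all add: polar_comp_fun_def)

lemma lmeasurable_polar_seq:
  "A \<in> lmeasurable \<Longrightarrow> polar_comp_set (polar_seq (1::real) b n) A \<in> lmeasurable"
  by (induction n) (auto intro: lmeasurable_polar_set_real)

lemma leb_dist_polar_seq_push_le:
  assumes A: "A \<in> lmeasurable" and m: "mono m" and b: "\<And>j. 2 * m j - 2 * b j = mass A (m j)"
  shows "leb_dist (polar_comp_set (polar_seq 1 b n) A) (push A (m n))
    \<le> 2 * mass A (m 0) + 2 * (\<Sum>j<n. min (measure lebesgue (A \<inter> {m j<..m (Suc j)})) (measure lebesgue ({m j<..m (Suc j)} - A)))"
proof (induction n)
  case 0
  show ?case using leb_dist_push_le[OF A, of "m 0"] by simp
next
  case (Suc n)
  let ?Q = "polar_comp_set (polar_seq 1 b n) A" and ?c = "(b n + b (Suc n)) / 2"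
  have "leb_dist (polar_set (1, ?c) ?Q) (push A (m (Suc n)))
     \<le> leb_dist (polar_set (1, ?c) ?Q) (polar_set (1, ?c) (push A (m n)))
       + leb_dist (polar_set (1, ?c) (push A (m n))) (push A (m (Suc n)))"
    using A by (intro leb_dist_triangle lmeasurable_polar_set_real lmeasurable_polar_seq lmeasurable_push)
  moreover have "leb_dist (polar_set (1, ?c) ?Q) (polar_set (1, ?c) (push A (m n))) \<le> leb_dist ?Q (push A (m n))"
    using A by (intro leb_dist_polar_set lmeasurable_polar_seq lmeasurable_push)
  moreover note leb_dist_polar_push_le[OF A _ b b, of n "Suc n"] Suc
  moreover have "m n \<le> m (Suc n)" using m by (simp add: monoD)
  ultimately show ?case by simp
qed

text \<open>With absorbed mass \<open>a\<close> and gap \<open>g\<close> between the endpoints, the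
  centres differ by \<open>a / 2 + g\<close> while the endpoints differ by \<open>a + g\<close>.
  Hence the endpoint increases with the centre and moves at most twice as fast, which turns a fine
  grid of centres into short windows.\<close>

lemma push_end_mono:
  assumes A: "A \<in> lmeasurable" and b: "2 * m - 2 * b = mass A m" and b': "2 * m' - 2 * b' = mass A m'" and "b \<le> b'"
  shows "m \<le> m'" "m' - m \<le> 2 * b' - 2 * b"
proof -
  show *: "m \<le> m'"
  proof (rule ccontr)
    assume "\<not> m \<le> m'"
    then show False
      using mass_add[OF A, of m' m] measure_Int_add_Diff_Ioc[OF A, of m' m] assms
      by (smt (verit) measure_nonneg)
  qed
  show "m' - m \<le> 2 * b' - 2 * b"
  proof -
    define a g where "a = measure lebesgue (A \<inter> {m<..m'})" and "g = measure lebesgue ({m<..m'} - A)"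
    have "2 * m' - 2 * b' = mass A m + a" "a + g = m' - m" "0 \<le> g"
      using mass_add[OF A *] measure_Int_add_Diff_Ioc[OF A *] b' by (simp_all add: a_def g_def)
    then show ?thesis using b by linarith
  qed
qed

lemma push_end_unique:
  assumes "A \<in> lmeasurable" "2 * m - 2 * b = mass A m" "2 * m' - 2 * b = mass A m'"
  shows "m = m'"
  using push_end_mono(1)[OF assms(1,2,3)] push_end_mono(1)[OF assms(1,3,2)] by simp

text \<open>Intermediate values of \<open>2 * m - 2 * b - mass A m\<close> between
  \<open>m = b\<close> and \<open>m = b + measure lebesgue A\<close>; continuity holds because
  \<open>mass A\<close> is 1-Lipschitz.\<close>

lemma ex_push_end:
  assumes A: "A \<in> lmeasurable"
  shows "\<exists>m. 2 * m - 2 * b = mass A m"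
proof -
  have cont: "continuous_on UNIV (mass A)"
  proof (rule continuous_on_iff[THEN iffD2], intro ballI allI impI)
    fix x e :: real assume "0 < e"
    have *: "\<bar>mass A y - mass A x\<bar> \<le> \<bar>y - x\<bar>" for x y
    proof (induction x y rule: linorder_wlog)
      case (le x y)
      then show ?case
        using mass_add[OF A le] measure_Int_add_Diff_Ioc[OF A le] measure_nonneg[of lebesgue "{x<..y} - A"]
          measure_nonneg[of lebesgue "A \<inter> {x<..y}"] by linarith
    qed (simp add: abs_minus_commute)
    show "\<exists>d>0. \<forall>x'\<in>UNIV. dist x' x < d \<longrightarrow> dist (mass A x') (mass A x) < e"
      using \<open>0 < e\<close> * by (intro exI[of _ e]) (auto simp: dist_real_def intro: le_less_trans)
  qed
  have "\<exists>m. b \<le> m \<and> m \<le> b + measure lebesgue A \<and> 2 * m - 2 * b - mass A m = 0"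
  proof (rule IVT')
    show "2 * b - 2 * b - mass A b \<le> 0" using mass_nonneg[of A b] by simp
    show "0 \<le> 2 * (b + measure lebesgue A) - 2 * b - mass A (b + measure lebesgue A)"
      using mass_le[OF A, of "b + measure lebesgue A"] measure_nonneg[of lebesgue A]
      unfolding distrib_left by linarith
    show "continuous_on {b..b + measure lebesgue A} (\<lambda>m. 2 * m - 2 * b - mass A m)"
      by (intro continuous_intros continuous_on_subset[OF cont]) auto
  qed simp
  then show ?thesis by auto
qed

definition push_end :: "real set \<Rightarrow> real \<Rightarrow> real" where
  "push_end A b = (THE m. 2 * m - 2 * b = mass A m)"

lemma push_end:
  assumes "A \<in> lmeasurable"
  shows "2 * push_end A b - 2 * b = mass A (push_end A b)"
  unfolding push_end_def
  by (rule theI') (use ex_push_end[OF assms] push_end_unique[OF assms] in blast)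

text \<open>Steps of length \<open>1 / k\<close> from \<open>t - k\<close> (at \<open>j = 0\<close>) to \<open>t\<close> (at \<open>j = k * k\<close>).\<close>

definition grid :: "real \<Rightarrow> nat \<Rightarrow> nat \<Rightarrow> real" where
  "grid t k j = t - (real (k * k) - real j) / real k"

lemma leb_dist_polar_grid_tendsto:
  assumes A: "A \<in> lmeasurable"
  shows "(\<lambda>k. leb_dist (polar_comp_set (polar_seq 1 (grid t k) (k * k)) A) (push A (push_end A t))) \<longlonglongrightarrow> 0"
proof (rule LIMSEQ_I)
  fix r :: real assume r: "0 < r"
  \<comment> \<open>The final estimate is twice the initial mass plus twice the sum, so each may use
    up a quarter of \<open>r\<close>.\<close>
  then have r4: "0 < r / 4" by simp
  obtain M where M: "\<And>m. m \<le> M \<Longrightarrow> mass A m < r / 4" using mass_tendsto_at_bot[OF A r4] by blast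
  obtain d where d: "0 < d" and sum: "\<And>(m::nat \<Rightarrow> real) n. mono m \<Longrightarrow> (\<And>j. m (Suc j) - m j < d) \<Longrightarrow>
      (\<Sum>j<n. min (measure lebesgue (A \<inter> {m j<..m (Suc j)})) (measure lebesgue ({m j<..m (Suc j)} - A))) < r / 4"
    by (rule sum_min_gaps_le[OF A r4]) blast
  \<comment> \<open>\<open>N1\<close> makes the first centre \<open>t - k\<close> so far left that
    its endpoint, at most half the measure of \<open>A\<close> further right, lies below
    \<open>M\<close>; \<open>N2\<close> makes the window length, at most \<open>2 / k\<close>,
    smaller than \<open>d\<close>.\<close>
  obtain N1 :: nat where N1: "t + measure lebesgue A - M < real N1" using reals_Archimedean2 by blast
  obtain N2 :: nat where N2: "2 / d < real N2" using reals_Archimedean2 by blast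
  show "\<exists>no. \<forall>k\<ge>no. norm (leb_dist (polar_comp_set (polar_seq 1 (grid t k) (k * k)) A) (push A (push_end A t)) - 0) < r"
  proof (intro exI allI impI)
    fix k assume k: "max 1 (max N1 N2) \<le> k"
    define m where "m j = push_end A (grid t k j)" for j
    have b: "2 * m j - 2 * grid t k j = mass A (m j)" for j unfolding m_def by (rule push_end[OF A])
    have g: "grid t k i \<le> grid t k j" if "i \<le> j" for i j
      using that k by (simp add: grid_def divide_right_mono)
    have mono: "mono m" using push_end_mono(1)[OF A b b g] by (simp add: mono_def)
    have step: "m (Suc j) - m j < d" for j
    proof -
      have "m (Suc j) - m j \<le> 2 * grid t k (Suc j) - 2 * grid t k j"
        by (rule push_end_mono(2)[OF A b b g]) simp
      also have "\<dots> = 2 / real k"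
        using k by (simp add: grid_def field_simps)
      also have "\<dots> < d"
      proof -
        have "2 / d < real k" using N2 k by linarith
        then show ?thesis using d k by (simp add: field_simps)
      qed
      finally show ?thesis .
    qed
    have "2 * m 0 - 2 * grid t k 0 \<le> measure lebesgue A" using b[of 0] mass_le[OF A, of "m 0"] by simp
    moreover have "grid t k 0 = t - real k" using k by (simp add: grid_def)
    moreover have "real N1 \<le> real k" using k by simp
    ultimately have "m 0 \<le> M" using N1 measure_nonneg[of lebesgue A] by linarith
    then have m0: "mass A (m 0) < r / 4" by (rule M)
    have "grid t k (k * k) = t" by (simp add: grid_def)
    then have "m (k * k) = push_end A t" by (simp add: m_def)
    then have "leb_dist (polar_comp_set (polar_seq 1 (grid t k) (k * k)) A) (push A (push_end A t)) < r"
      using leb_dist_polar_seq_push_le[OF A mono b, of "k * k"] sum[OF mono step, of "k * k"] m0 by simp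
    then show "norm (leb_dist (polar_comp_set (polar_seq 1 (grid t k) (k * k)) A) (push A (push_end A t)) - 0) < r"
      by (simp add: leb_dist_def)
  qed
qed

section \<open>Identification with the one-dimensional Solynin map\<close>

lemma push_push_end:
  assumes A: "A \<in> lmeasurable"
  shows "push A (push_end A t) = {2 * t - push_end A t..push_end A t} \<union> (A \<inter> {push_end A t<..})"
proof -
  have "push_end A t - mass A (push_end A t) = 2 * t - push_end A t"
    using push_end[OF A, of t] by linarith
  then show ?thesis by (simp only: push_def)
qed

text \<open>The interval swallows \<open>A\<close> between \<open>t\<close> and
  \<open>t + r\<close>, and the part of \<open>A\<close> beyond \<open>t + r\<close> contributes the
  same finite amount to both sides and cancels.\<close>

lemma push_end_radius_iff:
  assumes A: "A \<in> lmeasurable" and r: "0 \<le> r"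
  shows "emeasure lebesgue ({t - r..t + r} \<union> (A \<inter> {t..})) = emeasure lebesgue A \<longleftrightarrow> 2 * r = mass A (t + r)"
proof -
  have eq: "{t - r..t + r} \<union> (A \<inter> {t..}) = {t - r..t + r} \<union> (A \<inter> {t + r<..})"
    using r by auto
  have m1: "A \<inter> {..t + r} \<in> lmeasurable" "A \<inter> {t + r<..} \<in> lmeasurable"
    using A by (auto intro!: lmeasurable_Int_borel)
  have "A = (A \<inter> {..t + r}) \<union> (A \<inter> {t + r<..})" by auto
  moreover have "A \<inter> {t + r<..} - A \<inter> {..t + r} = A \<inter> {t + r<..}" by auto
  ultimately have 1: "measure lebesgue A = mass A (t + r) + measure lebesgue (A \<inter> {t + r<..})"
    unfolding mass_def using m1 measure_Un2[of "A \<inter> {..t + r}" lebesgue "A \<inter> {t + r<..}"]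
    by simp
  have "(A \<inter> {t + r<..}) - {t - r..t + r} = A \<inter> {t + r<..}" by auto
  then have 2: "measure lebesgue ({t - r..t + r} \<union> (A \<inter> {t + r<..})) = 2 * r + measure lebesgue (A \<inter> {t + r<..})"
    using m1 r measure_Un2[of "{t - r..t + r}" lebesgue "A \<inter> {t + r<..}"] by simp
  have "{t - r..t + r} \<union> (A \<inter> {t + r<..}) \<in> lmeasurable" using m1 by auto
  then show ?thesis
    using A 1 2 r mass_nonneg[of A "t + r"] unfolding eq
    by (simp add: emeasure_eq_measure2 flip: ennreal_plus)
qed

text \<open>The measure condition on \<open>r\<close> is the balance equation for the endpoint
  \<open>t + r\<close>, so uniqueness of that endpoint forces the value picked by
  \<open>SOME\<close>.\<close>

lemma solynin1_eq_push:
  assumes A: "A \<in> lmeasurable"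
  shows "solynin1 t A = push A (push_end A t)"
proof -
  define m where "m = push_end A t"
  have m: "2 * m - 2 * t = mass A m" unfolding m_def by (rule push_end[OF A])
  then have mt: "t \<le> m" using mass_nonneg[of A m] by simp
  define r where "r = (SOME r. r \<ge> 0 \<and>
      emeasure lebesgue ({t - r..t + r} \<union> (A \<inter> {t..})) = emeasure lebesgue A)"
  have "\<exists>r. r \<ge> 0 \<and> emeasure lebesgue ({t - r..t + r} \<union> (A \<inter> {t..})) = emeasure lebesgue A"
    using push_end_radius_iff[OF A, of "m - t" t] m mt by (intro exI[of _ "m - t"]) simp
  from someI_ex[OF this, folded r_def]
  have r: "r \<ge> 0" "emeasure lebesgue ({t - r..t + r} \<union> (A \<inter> {t..})) = emeasure lebesgue A"
    by blast+
  then have "2 * (t + r) - 2 * t = mass A (t + r)" using push_end_radius_iff[OF A, of r t] by simp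
  then have tr: "t + r = m" using push_end_unique[OF A _ m] by blast
  have "solynin1 t A = {t - r..t + r} \<union> (A \<inter> {t..})"
    unfolding solynin1_def Let_def r_def by (rule refl)
  also have "\<dots> = {2 * t - m..m} \<union> (A \<inter> {m<..})" using tr r(1) by auto
  also have "\<dots> = push A m" unfolding m_def push_push_end[OF A] by (rule refl)
  finally show ?thesis unfolding m_def .
qed

section \<open>Functions on the line\<close>

text \<open>For non-measurable functions \<^const>\<open>nn_integral\<close> is a lower integral. Working with it as such
  avoids proving that Solynin rearrangements are measurable in higher dimensions.\<close>

lemma nn_integral_tendsto_0_dominated:
  fixes h :: "nat \<Rightarrow> 'a \<Rightarrow> ennreal"
  assumes w [measurable]: "w \<in> borel_measurable M" and fin: "(\<integral>\<^sup>+x. w x \<partial>M) < \<infinity>"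
    and le: "AE x in M. \<forall>k. h k x \<le> w x" and lim: "AE x in M. (\<lambda>k. h k x) \<longlonglongrightarrow> 0"
  shows "(\<lambda>k. \<integral>\<^sup>+x. h k x \<partial>M) \<longlonglongrightarrow> 0"
proof -
  \<comment> \<open>Measurable stand-ins: simple functions below \<open>h k\<close> that reach the
    lower integral up to \<open>1 / Suc k\<close>. Ordinary dominated convergence applies to them,
    and the slack vanishes in the limit.\<close>
  have "\<exists>g. simple_function M g \<and> g \<le> h k \<and> (\<integral>\<^sup>+x. h k x \<partial>M) \<le> integral\<^sup>S M g + ennreal (1 / Suc k)" for k
  proof -
    have "(\<integral>\<^sup>+x. h k x \<partial>M) \<le> (\<integral>\<^sup>+x. w x \<partial>M)"
      by (rule nn_integral_mono_AE) (use le in auto)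
    then have "(\<integral>\<^sup>+x. h k x \<partial>M) \<noteq> \<infinity>" using fin by auto
    moreover have "{g. simple_function M g \<and> g \<le> h k} \<noteq> {}"
      by (auto intro!: exI[of _ "\<lambda>_. 0"] simp: le_fun_def)
    ultimately have "\<exists>g\<in>{g. simple_function M g \<and> g \<le> h k}. (\<integral>\<^sup>+x. h k x \<partial>M) < integral\<^sup>S M g + ennreal (1 / Suc k)"
      by (intro SUP_approx_ennreal) (auto simp: nn_integral_def)
    then show ?thesis by (auto intro: less_imp_le)
  qed
  then obtain g where g: "\<And>k. simple_function M (g k)" "\<And>k. g k \<le> h k"
    "\<And>k. (\<integral>\<^sup>+x. h k x \<partial>M) \<le> integral\<^sup>S M (g k) + ennreal (1 / Suc k)" by metis
  have gM [measurable]: "g k \<in> borel_measurable M" for k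
    using g(1) by (rule borel_measurable_simple_function)
  have "(\<lambda>k. \<integral>\<^sup>+x. g k x \<partial>M) \<longlonglongrightarrow> (\<integral>\<^sup>+x. 0 \<partial>M)"
  proof (rule nn_integral_dominated_convergence[where w = w])
    show "AE x in M. g k x \<le> w x" for k
      using le by eventually_elim (use g(2)[of k] in \<open>auto simp: le_fun_def intro: order_trans\<close>)
    show "AE x in M. (\<lambda>k. g k x) \<longlonglongrightarrow> 0"
      using lim
    proof eventually_elim
      case (elim x)
      show ?case
        by (rule tendsto_sandwich[OF _ _ tendsto_const elim])
           (use g(2) in \<open>auto simp: le_fun_def\<close>)
    qed
  qed (use fin in auto)
  moreover have "(\<lambda>k. ennreal (1 / Suc k)) \<longlonglongrightarrow> ennreal 0"
    by (intro tendsto_ennrealI) (rule LIMSEQ_Suc[OF lim_1_over_n])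
  ultimately have "(\<lambda>k. (\<integral>\<^sup>+x. g k x \<partial>M) + ennreal (1 / Suc k)) \<longlonglongrightarrow> (\<integral>\<^sup>+x. 0 \<partial>M) + ennreal 0"
    by (rule tendsto_add)
  then have *: "(\<lambda>k. (\<integral>\<^sup>+x. g k x \<partial>M) + ennreal (1 / Suc k)) \<longlonglongrightarrow> 0" by simp
  have "(\<integral>\<^sup>+x. h k x \<partial>M) \<le> (\<integral>\<^sup>+x. g k x \<partial>M) + ennreal (1 / Suc k)" for k
    using g(3)[of k] by (simp only: nn_integral_eq_simple_integral[OF g(1)])
  then show ?thesis
    by (intro tendsto_sandwich[OF _ _ tendsto_const *] always_eventually allI) simp_all
qed

lemma sigma_finite_completion:
  assumes "sigma_finite_measure M"
  shows "sigma_finite_measure (completion M)"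
proof -
  interpret sigma_finite_measure M by fact
  obtain A where "countable A" "A \<subseteq> sets M" "\<Union>A = space M" "\<forall>a\<in>A. emeasure M a \<noteq> \<infinity>"
    using sigma_finite_countable by auto
  then show ?thesis
    by (intro sigma_finite_measure.intro exI[of _ A]) (auto simp: subset_eq)
qed

interpretation lebesgue: sigma_finite_measure "lebesgue :: real measure"
  by (rule sigma_finite_completion[OF sigma_finite_lborel])

text \<open>Points carry Lebesgue measure because the functions are only Lebesgue measurable; for
  the levels Borel measure is enough.\<close>

interpretation lebesgue_lborel: pair_sigma_finite "lebesgue :: real measure" "lborel :: real measure" ..

text \<open>Superadditivity of the \<open>p\<close>-th power: after division by the larger number,
  the two ratios lie in the unit interval and sum to 1, and raising them to a power
  \<open>p \<ge> 1\<close> only shrinks them.\<close>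

lemma powr_abs_diff_le:
  fixes a b p :: real
  assumes "0 \<le> a" "0 \<le> b" "1 \<le> p"
  shows "\<bar>a - b\<bar> powr p \<le> \<bar>a powr p - b powr p\<bar>"
  using assms(1,2)
proof (induction a b rule: linorder_wlog)
  case (le b a)
  show ?case
  proof (cases "a = 0")
    case False
    then have a: "0 < a" using le by simp
    have "((a - b) / a) powr p \<le> ((a - b) / a) powr 1" "(b / a) powr p \<le> (b / a) powr 1"
      using a le assms(3) by (intro powr_mono'; simp)+
    then have "((a - b) / a) powr p + (b / a) powr p \<le> (a - b) / a + b / a"
      using a le by (simp add: divide_nonneg_pos)
    also have "\<dots> = 1" using a by (simp add: field_simps)
    finally have "(a - b) powr p + b powr p \<le> a powr p"
      using a le by (simp add: powr_divide field_simps)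
    moreover have "b powr p \<le> a powr p" using le assms(3) by (intro powr_mono2) auto
    moreover have "\<bar>b - a\<bar> = a - b" using le by simp
    ultimately show ?thesis by simp
  qed (use le in auto)
qed (auto simp: abs_minus_commute)

lemma solynin_set_real: "solynin_set (1, t) A = solynin1 t (A :: real set)"
  by (simp add: solynin_set_def)

lemma polar_fun_gt_iff: "\<sigma> < polar_fun H f x \<longleftrightarrow> x \<in> polar_set H {y. \<sigma> < f y}"
proof (cases "x \<bullet> fst H = snd H")
  case True
  then have "hyp_reflect H x = x" by (simp add: hyp_reflect_def)
  then show ?thesis by (auto simp: polar_fun_def polar_set_def)
qed (auto simp: polar_fun_def polar_set_def)

lemma polar_comp_fun_gt_iff: "\<sigma> < polar_comp_fun Hs f x \<longleftrightarrow> x \<in> polar_comp_set Hs {y. \<sigma> < f y}"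
proof (induction Hs arbitrary: x)
  case (Cons H Hs)
  have "{y. \<sigma> < polar_comp_fun Hs f y} = polar_comp_set Hs {y. \<sigma> < f y}" using Cons.IH by auto
  then show ?case by (simp add: polar_fun_gt_iff)
qed simp

lemma polar_comp_fun_nonneg: "(\<And>x. 0 \<le> f x) \<Longrightarrow> 0 \<le> polar_comp_fun Hs f x"
  by (induction Hs arbitrary: x) (auto simp: polar_fun_def le_max_iff_disj)

lemma measurable_polar_fun_real:
  assumes [measurable]: "f \<in> borel_measurable lebesgue"
  shows "polar_fun (1::real, b) f \<in> borel_measurable lebesgue"
proof -
  have [measurable]: "(\<lambda>x. f (2 * b - x)) \<in> borel_measurable lebesgue"
    using measurable_compose[OF measurable_reflect_lebesgue assms] .
  have [measurable]: "{b..} \<in> sets lebesgue" by auto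
  have "polar_fun (1, b) f = (\<lambda>x. if x \<in> {b..} then max (f x) (f (2 * b - x)) else min (f x) (f (2 * b - x)))"
    by (auto simp: polar_fun_def hyp_reflect_real fun_eq_iff)
  also have "\<dots> \<in> borel_measurable lebesgue" by measurable
  finally show ?thesis .
qed

lemma measurable_polar_seq_real:
  "f \<in> borel_measurable lebesgue \<Longrightarrow> polar_comp_fun (polar_seq (1::real) b n) f \<in> borel_measurable lebesgue"
  by (induction n) (auto intro: measurable_polar_fun_real)

lemma emeasure_polar_seq_le:
  "A \<in> sets lebesgue \<Longrightarrow> polar_comp_set (polar_seq (1::real) b n) A \<in> sets lebesgue \<and>
     emeasure lebesgue (polar_comp_set (polar_seq (1::real) b n) A) \<le> emeasure lebesgue A"
  by (induction n) (auto intro: sets_polar_set_real order_trans[OF emeasure_polar_set_real_le])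

text \<open>Seen from \<open>B\<close>, the endpoint \<open>m\<close> of \<open>A\<close> belongs to
  the centre \<open>(2 * m - mass B m) / 2\<close>, which is at most \<open>t\<close>; monotonicity
  of endpoints in the centre concludes. This is what makes the images of superlevel sets
  nested.\<close>

lemma push_end_subset:
  assumes A: "A \<in> lmeasurable" and B: "B \<in> lmeasurable" and "A \<subseteq> B"
  shows "push_end A t \<le> push_end B t" "push A (push_end A t) \<subseteq> push B (push_end B t)"
proof -
  define m where "m = push_end A t"
  have m: "2 * m - 2 * t = mass A m" unfolding m_def by (rule push_end[OF A])
  have "mass A m \<le> mass B m" unfolding mass_def
    by (rule measure_mono_fmeasurable) (use assms in \<open>auto intro!: lmeasurable_Int_borel simp: fmeasurableD\<close>)
  then show *: "push_end A t \<le> push_end B t"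
    using push_end_mono(1)[OF B _ push_end[OF B], of m "(2 * m - mass B m) / 2" t] m
    by (simp add: m_def field_simps)
  have "t \<le> push_end A t" using m mass_nonneg[of A m] by (simp add: m_def)
  then show "push A (push_end A t) \<subseteq> push B (push_end B t)"
    using * assms(3) unfolding push_push_end[OF A] push_push_end[OF B] by auto
qed

lemma measure_push_le:
  assumes A: "A \<in> lmeasurable"
  shows "measure lebesgue (push A m) \<le> measure lebesgue A"
proof -
  have m1: "A \<inter> {..m} \<in> lmeasurable" "A \<inter> {m<..} \<in> lmeasurable"
    using A by (auto intro!: lmeasurable_Int_borel)
  have "A = (A \<inter> {..m}) \<union> (A \<inter> {m<..})" "A \<inter> {m<..} - A \<inter> {..m} = A \<inter> {m<..}" by auto
  then have "measure lebesgue A = mass A m + measure lebesgue (A \<inter> {m<..})"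
    unfolding mass_def using m1 measure_Un2[of "A \<inter> {..m}" lebesgue "A \<inter> {m<..}"] by simp
  moreover have "measure lebesgue (push A m) \<le> measure lebesgue {m - mass A m..m} + measure lebesgue (A \<inter> {m<..})"
    unfolding push_def by (rule measure_Un_le) (use m1 in \<open>auto simp: fmeasurableD\<close>)
  ultimately show ?thesis using mass_nonneg[of A m] by simp
qed

text \<open>Crude, but uniform in the centres and the number of steps: it supplies the dominating
  function when the errors are integrated over all levels.\<close>

lemma leb_dist_polar_seq_push_bound:
  assumes A: "A \<in> lmeasurable"
  shows "leb_dist (polar_comp_set (polar_seq 1 b n) A) (push A m) \<le> 2 * measure lebesgue A"
proof -
  let ?P = "polar_comp_set (polar_seq 1 b n) A"
  have P: "?P \<in> lmeasurable" by (rule lmeasurable_polar_seq[OF A])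
  have "leb_dist ?P (push A m) \<le> measure lebesgue (?P \<union> push A m)"
    using P lmeasurable_push[OF A] by (intro leb_dist_le) auto
  also have "\<dots> \<le> measure lebesgue ?P + measure lebesgue (push A m)"
    using P lmeasurable_push[OF A] by (intro measure_Un_le) (auto simp: fmeasurableD)
  also have "measure lebesgue ?P \<le> measure lebesgue A"
    using emeasure_polar_seq_le[of A b n] A P by (simp add: emeasure_eq_measure2 fmeasurableD)
  also have "measure lebesgue (push A m) \<le> measure lebesgue A" by (rule measure_push_le[OF A])
  finally show ?thesis by simp
qed

section \<open>Layer cake for one function on the line\<close>

context
  fixes F :: "real \<Rightarrow> real" and p t :: real
  assumes F [measurable]: "F \<in> borel_measurable lebesgue" and F0: "\<And>x. 0 \<le> F x" and p: "1 \<le> p"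
    and fin: "(\<integral>\<^sup>+x. ennreal (F x powr p) \<partial>lebesgue) < \<infinity>"
begin

abbreviation (input) lev :: "real \<Rightarrow> real set" where
  "lev s \<equiv> {y. s < F y}"

abbreviation (input) lev_push :: "real \<Rightarrow> real set" where
  "lev_push s \<equiv> push (lev s) (push_end (lev s) t)"

lemma sets_lev: "lev s \<in> sets lebesgue"
  using borel_measurable_less[OF measurable_const[of s] F] by (simp add: pred_def)

lemma lev_markov:
  assumes "0 < s"
  shows "ennreal (s powr p) * emeasure lebesgue (lev s) \<le> (\<integral>\<^sup>+x. ennreal (F x powr p) \<partial>lebesgue)"
proof -
  have "ennreal (s powr p) * emeasure lebesgue (lev s) = (\<integral>\<^sup>+x. ennreal (s powr p) * indicator (lev s) x \<partial>lebesgue)"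
    using sets_lev by (simp add: nn_integral_cmult_indicator)
  also have "\<dots> \<le> (\<integral>\<^sup>+x. ennreal (F x powr p) \<partial>lebesgue)"
    using assms p by (intro nn_integral_mono) (auto simp: indicator_def intro!: ennreal_leI powr_mono2)
  finally show ?thesis .
qed

lemma lev_lmeasurable:
  assumes "0 < s"
  shows "lev s \<in> lmeasurable"
proof -
  have "ennreal (s powr p) * emeasure lebesgue (lev s) < \<infinity>"
    using lev_markov[OF assms] fin by (rule le_less_trans)
  then have "emeasure lebesgue (lev s) < \<infinity>"
    using assms by (auto simp: ennreal_mult_less_top)
  then show ?thesis using sets_lev by (auto simp: fmeasurable_def)
qed

lemma solynin_fun_real:
  "solynin_fun (1, t) F x = Sup ({0} \<union> {s. 0 < s \<and> x \<in> lev_push s})"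
  unfolding solynin_fun_def solynin_set_real
  by (intro arg_cong[where f = Sup] arg_cong2[where f = "(\<union>)"] refl Collect_cong)
     (auto simp: solynin1_eq_push[OF lev_lmeasurable])

lemma lev_push_mono: "0 < s \<Longrightarrow> s \<le> s' \<Longrightarrow> lev_push s' \<subseteq> lev_push s"
  by (intro push_end_subset lev_lmeasurable) auto

text \<open>If \<open>x\<close> lies in the image at a level above \<open>F x\<close>, it lies in
  the centred interval, so the level set has measure at least \<open>2 * \<bar>x - t\<bar>\<close>,
  and Markov's inequality bounds the level. At \<open>x = t\<close> this bound degenerates.\<close>

lemma lev_push_bdd:
  assumes x: "x \<noteq> t"
  shows "bdd_above ({0} \<union> {s. 0 < s \<and> x \<in> lev_push s})"
proof -
  define J where "J = enn2real (\<integral>\<^sup>+x. ennreal (F x powr p) \<partial>lebesgue)"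
  have J: "ennreal J = (\<integral>\<^sup>+x. ennreal (F x powr p) \<partial>lebesgue)" "0 \<le> J"
    using fin by (auto simp: J_def)
  define M where "M = max (F x) ((J / (2 * \<bar>x - t\<bar>)) powr (1 / p))"
  have M0: "0 \<le> M" using F0[of x] by (simp add: M_def)
  have "s \<le> M" if s: "0 < s" "x \<in> lev_push s" for s
  proof (rule ccontr)
    assume "\<not> s \<le> M"
    then have sM: "F x < s" "(J / (2 * \<bar>x - t\<bar>)) powr (1 / p) < s" by (auto simp: M_def)
    have L: "lev s \<in> lmeasurable" using s(1) by (rule lev_lmeasurable)
    have "2 * \<bar>x - t\<bar> \<le> 2 * push_end (lev s) t - 2 * t"
      using s(2) sM(1) unfolding push_push_end[OF L] by (auto simp: abs_if)
    also have "\<dots> \<le> measure lebesgue (lev s)"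
      using push_end[OF L, of t] mass_le[OF L] by simp
    finally have "s powr p * (2 * \<bar>x - t\<bar>) \<le> s powr p * measure lebesgue (lev s)"
      by (intro mult_left_mono) auto
    also have "\<dots> \<le> J"
      using lev_markov[OF s(1)] J(2)
      unfolding emeasure_eq_measure2[OF L] J(1)[symmetric] by (simp flip: ennreal_mult)
    finally have "s powr p \<le> J / (2 * \<bar>x - t\<bar>)" using x by (simp add: field_simps)
    then have "(s powr p) powr (1 / p) \<le> (J / (2 * \<bar>x - t\<bar>)) powr (1 / p)"
      using p by (intro powr_mono2) auto
    then show False using sM(2) s(1) p by (simp add: powr_powr)
  qed
  then show ?thesis using M0 by (intro bdd_aboveI[of _ M]) auto
qed

text \<open>The images decrease in \<open>s\<close>, but the supremum need not be attained. The two
  implications leave open only the level equal to the value itself, a single point in the integral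
  over levels.\<close>

lemma solynin_fun_level:
  assumes "x \<noteq> t" "0 < s"
  shows "x \<in> lev_push s \<Longrightarrow> s \<le> solynin_fun (1, t) F x"
    and "s < solynin_fun (1, t) F x \<Longrightarrow> x \<in> lev_push s"
proof -
  note bdd = lev_push_bdd[OF assms(1)]
  show "s \<le> solynin_fun (1, t) F x" if "x \<in> lev_push s"
    unfolding solynin_fun_real by (rule cSup_upper[OF _ bdd]) (use that assms in auto)
  show "x \<in> lev_push s" if "s < solynin_fun (1, t) F x"
  proof -
    obtain s' where "s' \<in> {0} \<union> {s. 0 < s \<and> x \<in> lev_push s}" "s < s'"
      by (rule less_cSupE[OF \<open>s < solynin_fun (1, t) F x\<close>[unfolded solynin_fun_real]]) auto
    then show ?thesis using assms(2) lev_push_mono[of s s'] by auto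
  qed
qed

lemma solynin_fun_nonneg:
  assumes "x \<noteq> t"
  shows "0 \<le> solynin_fun (1, t) F x"
  unfolding solynin_fun_real by (rule cSup_upper[OF _ lev_push_bdd[OF assms]]) simp

text \<open>Layer cake with the levels parametrised by \<open>\<tau> powr (1 / p)\<close>, which spares the weight
  \<open>p \<tau> powr (p - 1)\<close>.\<close>

lemma layer_cake_le:
  assumes x: "x \<noteq> t" and G: "0 \<le> G x"
  shows "ennreal (\<bar>G x - solynin_fun (1, t) F x\<bar> powr p) \<le>
    (\<integral>\<^sup>+\<tau>. indicator {(x, \<tau>). 0 < \<tau> \<and> (\<tau> powr (1 / p) < G x) \<noteq> (x \<in> lev_push (\<tau> powr (1 / p)))} (x, \<tau>) \<partial>lborel)"
    (is "_ \<le> (\<integral>\<^sup>+\<tau>. indicator ?S (x, \<tau>) \<partial>lborel)")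
proof -
  define a b where "a = G x" and "b = solynin_fun (1, t) F x"
  have ab: "0 \<le> a" "0 \<le> b" using G solynin_fun_nonneg[OF x] by (simp_all add: a_def b_def)
  define l u where "l = min (a powr p) (b powr p)" and "u = max (a powr p) (b powr p)"
  have l0: "0 \<le> l" by (simp add: l_def)
  have "\<bar>a - b\<bar> powr p \<le> \<bar>a powr p - b powr p\<bar>" by (rule powr_abs_diff_le[OF ab p])
  also have "\<dots> = u - l" by (simp add: l_def u_def)
  finally have "ennreal (\<bar>a - b\<bar> powr p) \<le> ennreal (u - l)" by (rule ennreal_leI)
  also have "\<dots> = (\<integral>\<^sup>+\<tau>. indicator {l<..<u} \<tau> \<partial>lborel)"
    by (simp add: l_def u_def)
  \<comment> \<open>For \<open>\<tau>\<close> strictly between \<open>l\<close> and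
    \<open>u\<close>, the level \<open>\<tau> powr (1 / p)\<close> lies strictly between
    \<open>a\<close> and \<open>b\<close>, so exactly one of the two membership conditions holds
    there.\<close>
  also have "\<dots> \<le> (\<integral>\<^sup>+\<tau>. indicator ?S (x, \<tau>) \<partial>lborel)"
  proof (rule nn_integral_mono)
    fix \<tau> :: real
    show "indicator {l<..<u} \<tau> \<le> (indicator ?S (x, \<tau>) :: ennreal)"
    proof (cases "\<tau> \<in> {l<..<u}")
      case True
      define s where "s = \<tau> powr (1 / p)"
      have \<tau>: "0 < \<tau>" using True l0 by auto
      have s: "0 < s" using \<tau> by (simp add: s_def)
      have sp: "s powr p = \<tau>" using \<tau> p by (simp add: s_def powr_powr)
      have cmp: "(c powr p < \<tau> \<longleftrightarrow> c < s) \<and> (\<tau> < c powr p \<longleftrightarrow> s < c)" if "0 \<le> c" for c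
        using powr_less_cancel2[of p c s] powr_less_mono2[of p c s] powr_less_mono2[of p s c]
          powr_less_cancel2[of p s c] that s p sp
        by (smt (verit) powr_mono2)
      have "(s < a) \<noteq> (x \<in> lev_push s)"
      proof (cases "a powr p \<le> b powr p")
        case True
        then have "a powr p < \<tau>" "\<tau> < b powr p" using \<open>\<tau> \<in> {l<..<u}\<close> by (auto simp: l_def u_def)
        then have "\<not> s < a" "s < b" using cmp ab by auto
        then show ?thesis using solynin_fun_level(2)[OF x s] by (auto simp: b_def)
      next
        case False
        then have "b powr p < \<tau>" "\<tau> < a powr p" using \<open>\<tau> \<in> {l<..<u}\<close> by (auto simp: l_def u_def)
        then have "s < a" "\<not> s \<le> b" using cmp ab by auto
        then show ?thesis using solynin_fun_level(1)[OF x s] by (auto simp: b_def)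
      qed
      then show ?thesis using \<tau> by (simp add: indicator_def a_def s_def)
    qed simp
  qed
  finally show ?thesis by (simp add: a_def b_def)
qed

text \<open>Fubini needs joint measurability. The image at a level is described by inequalities
  between \<open>x\<close>, \<open>F x\<close> and the endpoint, and the endpoint is a decreasing,
  hence Borel, function of the level.\<close>

lemma measurable_level_error:
  assumes G [measurable]: "G \<in> borel_measurable lebesgue"
  shows "{(x, \<tau>). 0 < \<tau> \<and> (\<tau> powr (1 / p) < G x) \<noteq> (x \<in> lev_push (\<tau> powr (1 / p)))}
           \<in> sets (lebesgue \<Otimes>\<^sub>M lborel)"
proof -
  \<comment> \<open>The value \<open>t\<close> at nonpositive \<open>\<tau>\<close> is a mere
    default, as only positive levels are compared.\<close>
  define e where "e \<tau> = (if \<tau> \<in> {0<..} then push_end (lev (\<tau> powr (1 / p))) t else t)" for \<tau> :: real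
  have "mono_on {0<..} (\<lambda>\<tau>. - push_end (lev (\<tau> powr (1 / p))) t)"
  proof (rule mono_onI)
    fix r s :: real assume "r \<in> {0<..}" "s \<in> {0<..}" "r \<le> s"
    moreover then have "r powr (1 / p) \<le> s powr (1 / p)" using p by (intro powr_mono2) auto
    ultimately show "- push_end (lev (r powr (1 / p))) t \<le> - push_end (lev (s powr (1 / p))) t"
      by (auto intro!: push_end_subset lev_lmeasurable)
  qed
  then have "(\<lambda>\<tau>. - push_end (lev (\<tau> powr (1 / p))) t) \<in> borel_measurable (restrict_space borel {0<..})"
    by (rule borel_measurable_mono_on_fnc)
  then have "(\<lambda>\<tau>. - (- push_end (lev (\<tau> powr (1 / p))) t)) \<in> borel_measurable (restrict_space borel {0<..})"
    by (rule borel_measurable_uminus)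
  then have [measurable]: "e \<in> borel_measurable borel"
    unfolding e_def by (subst measurable_If_restrict_space_iff) (auto simp: greaterThan_def)
  have "{(x, \<tau>). 0 < \<tau> \<and> (\<tau> powr (1 / p) < G x) \<noteq> (x \<in> lev_push (\<tau> powr (1 / p)))}
     = {z \<in> space (lebesgue \<Otimes>\<^sub>M lborel). 0 < snd z \<and> (snd z powr (1 / p) < G (fst z)) \<noteq>
          ((2 * t - e (snd z) \<le> fst z \<and> fst z \<le> e (snd z)) \<or> (snd z powr (1 / p) < F (fst z) \<and> e (snd z) < fst z))}"
    by (auto simp: space_pair_measure e_def push_push_end[OF lev_lmeasurable])
  also have "\<dots> \<in> sets (lebesgue \<Otimes>\<^sub>M lborel)"
  proof -
    have [measurable]: "(\<lambda>z. fst z) \<in> borel_measurable (lebesgue \<Otimes>\<^sub>M (lborel :: real measure))"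
      by (rule measurable_compose[OF measurable_fst]) (simp add: measurable_completion)
    show ?thesis by measurable
  qed
  finally show ?thesis .
qed

lemma nn_integral_lev:
  "(\<integral>\<^sup>+\<tau>. indicator {0<..} \<tau> * emeasure lebesgue (lev (\<tau> powr (1 / p))) \<partial>lborel) =
     (\<integral>\<^sup>+x. ennreal (F x powr p) \<partial>lebesgue)"
  "(\<lambda>\<tau>. indicator {0<..} \<tau> * emeasure lebesgue (lev (\<tau> powr (1 / p)))) \<in> borel_measurable lborel"
proof -
  define S where "S = {z \<in> space (lebesgue \<Otimes>\<^sub>M lborel). 0 < snd z \<and> snd z powr (1 / p) < F (fst z)}"
  have [measurable]: "S \<in> sets (lebesgue \<Otimes>\<^sub>M lborel)" unfolding S_def by measurable
  have S: "(\<integral>\<^sup>+x. indicator S (x, \<tau>) \<partial>lebesgue) = indicator {0<..} \<tau> * emeasure lebesgue (lev (\<tau> powr (1 / p)))" for \<tau>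
  proof -
    have "(\<integral>\<^sup>+x. indicator S (x, \<tau>) \<partial>lebesgue) = (\<integral>\<^sup>+x. indicator {0<..} \<tau> * indicator (lev (\<tau> powr (1 / p))) x \<partial>lebesgue)"
      by (intro nn_integral_cong) (auto simp: S_def indicator_def space_pair_measure)
    then show ?thesis by (simp only: nn_integral_cmult_indicator[OF sets_lev])
  qed
  have "(\<lambda>\<tau>. \<integral>\<^sup>+x. indicator S (x, \<tau>) \<partial>lebesgue) \<in> borel_measurable lborel" by measurable
  then show "(\<lambda>\<tau>. indicator {0<..} \<tau> * emeasure lebesgue (lev (\<tau> powr (1 / p)))) \<in> borel_measurable lborel"
    by (simp only: S)
  have "(\<integral>\<^sup>+\<tau>. \<integral>\<^sup>+x. indicator S (x, \<tau>) \<partial>lebesgue \<partial>lborel) = (\<integral>\<^sup>+x. \<integral>\<^sup>+\<tau>. indicator S (x, \<tau>) \<partial>lborel \<partial>lebesgue)"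
    by (rule lebesgue_lborel.Fubini') simp
  also have "\<dots> = (\<integral>\<^sup>+x. ennreal (F x powr p) \<partial>lebesgue)"
  proof (rule nn_integral_cong)
    fix x
    have "\<tau> powr (1 / p) < F x \<longleftrightarrow> \<tau> < F x powr p" if "0 < \<tau>" for \<tau>
    proof -
      have "(\<tau> powr (1 / p)) powr p = \<tau>" using that p by (simp add: powr_powr)
      then show ?thesis
        using powr_less_mono2[of p "\<tau> powr (1 / p)" "F x"] powr_mono2[of p "F x" "\<tau> powr (1 / p)"] p F0[of x]
        by (smt (verit) powr_ge_zero)
    qed
    then have "(\<integral>\<^sup>+\<tau>. indicator S (x, \<tau>) \<partial>lborel) = (\<integral>\<^sup>+\<tau>. indicator {0<..<F x powr p} \<tau> \<partial>lborel)"
      by (intro nn_integral_cong) (auto simp: S_def indicator_def space_pair_measure)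
    then show "(\<integral>\<^sup>+\<tau>. indicator S (x, \<tau>) \<partial>lborel) = ennreal (F x powr p)" by simp
  qed
  finally show "(\<integral>\<^sup>+\<tau>. indicator {0<..} \<tau> * emeasure lebesgue (lev (\<tau> powr (1 / p))) \<partial>lborel) =
     (\<integral>\<^sup>+x. ennreal (F x powr p) \<partial>lebesgue)" by (simp only: S)
qed

text \<open>Exchanging the integrals reduces functions to sets: for a fixed level, the section of
  the disagreement set is the symmetric difference of the polarized level set and its image.\<close>

lemma line_error_le:
  "(\<integral>\<^sup>+x. ennreal (\<bar>polar_comp_fun (polar_seq 1 b n) F x - solynin_fun (1, t) F x\<bar> powr p) \<partial>lebesgue)
     \<le> (\<integral>\<^sup>+\<tau>. indicator {0<..} \<tau> * ennreal (leb_dist (polar_comp_set (polar_seq 1 b n) (lev (\<tau> powr (1 / p))))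
             (lev_push (\<tau> powr (1 / p)))) \<partial>lborel)"
proof -
  define G where "G = polar_comp_fun (polar_seq 1 b n) F"
  define S where "S = {(x, \<tau>). 0 < \<tau> \<and> (\<tau> powr (1 / p) < G x) \<noteq> (x \<in> lev_push (\<tau> powr (1 / p)))}"
  have G0: "0 \<le> G x" for x unfolding G_def by (intro polar_comp_fun_nonneg F0)
  have G [measurable]: "G \<in> borel_measurable lebesgue" unfolding G_def by (rule measurable_polar_seq_real[OF F])
  have [measurable]: "S \<in> sets (lebesgue \<Otimes>\<^sub>M lborel)" unfolding S_def by (rule measurable_level_error[OF G])
  have "(\<integral>\<^sup>+x. ennreal (\<bar>G x - solynin_fun (1, t) F x\<bar> powr p) \<partial>lebesgue)
      \<le> (\<integral>\<^sup>+x. \<integral>\<^sup>+\<tau>. indicator S (x, \<tau>) \<partial>lborel \<partial>lebesgue)"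
  proof (rule nn_integral_mono_AE)
    have "AE x in lebesgue. x \<noteq> t"
      using AE_lborel_singleton[of t] by (rule AE_completion)
    then show "AE x in lebesgue. ennreal (\<bar>G x - solynin_fun (1, t) F x\<bar> powr p) \<le> (\<integral>\<^sup>+\<tau>. indicator S (x, \<tau>) \<partial>lborel)"
      by eventually_elim (unfold S_def, rule layer_cake_le[where G = G, OF _ G0])
  qed
  also have "\<dots> = (\<integral>\<^sup>+\<tau>. \<integral>\<^sup>+x. indicator S (x, \<tau>) \<partial>lebesgue \<partial>lborel)"
    by (rule lebesgue_lborel.Fubini'[symmetric]) simp
  also have "\<dots> = (\<integral>\<^sup>+\<tau>. indicator {0<..} \<tau> * ennreal (leb_dist (polar_comp_set (polar_seq 1 b n) (lev (\<tau> powr (1 / p))))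
             (lev_push (\<tau> powr (1 / p)))) \<partial>lborel)"
  proof (rule nn_integral_cong)
    fix \<tau> :: real
    show "(\<integral>\<^sup>+x. indicator S (x, \<tau>) \<partial>lebesgue) =
      indicator {0<..} \<tau> * ennreal (leb_dist (polar_comp_set (polar_seq 1 b n) (lev (\<tau> powr (1 / p))))
             (lev_push (\<tau> powr (1 / p))))"
    proof (cases "0 < \<tau>")
      case True
      let ?D = "sym_diff (polar_comp_set (polar_seq 1 b n) (lev (\<tau> powr (1 / p)))) (lev_push (\<tau> powr (1 / p)))"
      have L: "lev (\<tau> powr (1 / p)) \<in> lmeasurable" using True by (intro lev_lmeasurable) simp
      have D: "?D \<in> lmeasurable"
        by (intro fmeasurable.Un fmeasurable_Diff fmeasurableD lmeasurable_polar_seq lmeasurable_push L)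
      have "(\<integral>\<^sup>+x. indicator S (x, \<tau>) \<partial>lebesgue) = (\<integral>\<^sup>+x. indicator ?D x \<partial>lebesgue)"
        using True by (intro nn_integral_cong) (auto simp: S_def G_def indicator_def polar_comp_fun_gt_iff)
      also have "\<dots> = emeasure lebesgue ?D" using D by (simp add: fmeasurableD)
      also have "\<dots> = ennreal (measure lebesgue ?D)" by (rule emeasure_eq_measure2[OF D])
      finally show ?thesis using True by (simp add: leb_dist_def)
    qed (simp add: S_def)
  qed
  finally show ?thesis unfolding G_def .
qed

lemma level_error_le:
  "indicator {0<..} \<tau> * ennreal (leb_dist (polar_comp_set (polar_seq 1 b n) (lev (\<tau> powr (1 / p))))
             (lev_push (\<tau> powr (1 / p)))) \<le> 2 * (indicator {0<..} \<tau> * emeasure lebesgue (lev (\<tau> powr (1 / p))))"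
proof (cases "0 < \<tau>")
  case True
  then have L: "lev (\<tau> powr (1 / p)) \<in> lmeasurable" by (intro lev_lmeasurable) simp
  have "ennreal (leb_dist (polar_comp_set (polar_seq 1 b n) A) (push A (push_end A t))) \<le> 2 * emeasure lebesgue A"
    if A: "A \<in> lmeasurable" for A
    using leb_dist_polar_seq_push_bound[OF A, of b n "push_end A t"]
    unfolding emeasure_eq_measure2[OF A] by (metis ennreal_leI ennreal_mult' ennreal_numeral zero_le_numeral)
  from this[OF L] show ?thesis
    using True by (simp only: indicator_simps greaterThan_iff mult_1)
next
  case False
  then have "indicator {0<..} \<tau> = (0 :: ennreal)" by simp
  then show ?thesis by (simp only: mult_zero_left zero_le)
qed

lemma line_error_bound:
  "(\<integral>\<^sup>+x. ennreal (\<bar>polar_comp_fun (polar_seq 1 b n) F x - solynin_fun (1, t) F x\<bar> powr p) \<partial>lebesgue)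
     \<le> 2 * (\<integral>\<^sup>+x. ennreal (F x powr p) \<partial>lebesgue)"
proof -
  note line_error_le[of b n]
  also have "(\<integral>\<^sup>+\<tau>. indicator {0<..} \<tau> * ennreal (leb_dist (polar_comp_set (polar_seq 1 b n) (lev (\<tau> powr (1 / p))))
             (lev_push (\<tau> powr (1 / p)))) \<partial>lborel)
    \<le> (\<integral>\<^sup>+\<tau>. 2 * (indicator {0<..} \<tau> * emeasure lebesgue (lev (\<tau> powr (1 / p)))) \<partial>lborel)"
    by (intro nn_integral_mono level_error_le)
  also have "\<dots> = 2 * (\<integral>\<^sup>+x. ennreal (F x powr p) \<partial>lebesgue)"
    by (simp only: nn_integral_cmult[OF nn_integral_lev(2)] nn_integral_lev(1))
  finally show ?thesis .
qed

text \<open>At each positive level the error tends to 0 by the result for sets, all levels being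
  processed by the same list; dominated convergence in the level finishes.\<close>

lemma line_error_tendsto:
  "(\<lambda>k. \<integral>\<^sup>+x. ennreal (\<bar>polar_comp_fun (polar_seq 1 (grid t k) (k * k)) F x - solynin_fun (1, t) F x\<bar> powr p) \<partial>lebesgue)
     \<longlonglongrightarrow> 0"
proof (rule tendsto_sandwich[OF _ _ tendsto_const])
  show "(\<lambda>k. \<integral>\<^sup>+\<tau>. indicator {0<..} \<tau> * ennreal (leb_dist (polar_comp_set (polar_seq 1 (grid t k) (k * k)) (lev (\<tau> powr (1 / p))))
             (lev_push (\<tau> powr (1 / p)))) \<partial>lborel) \<longlonglongrightarrow> 0"
  proof (rule nn_integral_tendsto_0_dominated)
    show "(\<lambda>\<tau>. 2 * (indicator {0<..} \<tau> * emeasure lebesgue (lev (\<tau> powr (1 / p))))) \<in> borel_measurable lborel"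
      using nn_integral_lev(2) by measurable
    show "(\<integral>\<^sup>+\<tau>. 2 * (indicator {0<..} \<tau> * emeasure lebesgue (lev (\<tau> powr (1 / p)))) \<partial>lborel) < \<infinity>"
      using fin by (simp only: nn_integral_cmult[OF nn_integral_lev(2)] nn_integral_lev(1)) (simp add: ennreal_mult_less_top)
    show "AE \<tau> in lborel. (\<lambda>k. indicator {0<..} \<tau> * ennreal (leb_dist (polar_comp_set (polar_seq 1 (grid t k) (k * k)) (lev (\<tau> powr (1 / p))))
             (lev_push (\<tau> powr (1 / p))))) \<longlonglongrightarrow> 0"
    proof (rule AE_I2)
      fix \<tau> :: real
      show "(\<lambda>k. indicator {0<..} \<tau> * ennreal (leb_dist (polar_comp_set (polar_seq 1 (grid t k) (k * k)) (lev (\<tau> powr (1 / p))))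
             (lev_push (\<tau> powr (1 / p))))) \<longlonglongrightarrow> 0"
      proof (cases "0 < \<tau>")
        case True
        then have "lev (\<tau> powr (1 / p)) \<in> lmeasurable" by (intro lev_lmeasurable) simp
        from tendsto_ennrealI[OF leb_dist_polar_grid_tendsto[OF this, of t]] show ?thesis
          using True by simp
      qed simp
    qed
  qed (intro AE_I2 allI level_error_le)
qed (auto intro!: always_eventually line_error_le)

end

section \<open>Integration along lines\<close>

lemma nn_integral_lborel_shift:
  fixes f :: "'a::euclidean_space \<Rightarrow> ennreal"
  assumes [measurable]: "f \<in> borel_measurable borel"
  shows "(\<integral>\<^sup>+x. f (a + x) \<partial>lborel) = (\<integral>\<^sup>+x. f x \<partial>lborel)"
proof -
  have "(\<integral>\<^sup>+x. f x \<partial>lborel) = (\<integral>\<^sup>+x. f x \<partial>distr lborel borel ((+) a))"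
    by (simp only: lborel_distr_plus)
  also have "\<dots> = (\<integral>\<^sup>+x. f (a + x) \<partial>lborel)"
    by (rule nn_integral_distr) auto
  finally show ?thesis by simp
qed

text \<open>For a unit vector \<open>e\<close>, the point with \<open>e\<close>-coordinate
  \<open>s\<close> on the line through \<open>x\<close>; it depends on \<open>x\<close> only through
  that line.\<close>

definition line_pt :: "'a::euclidean_space \<Rightarrow> 'a \<Rightarrow> real \<Rightarrow> 'a" where
  "line_pt e x s = x + (s - x \<bullet> e) *\<^sub>R e"

lemma measurable_line_pt: "line_pt e x \<in> borel_measurable borel"
  unfolding line_pt_def by measurable

text \<open>Fubini along \<^term>\<open>e\<close> without splitting the space: the unit slab meets every line in
  length one, so translation invariance turns the integral over it of the line integrals into the
  integral over the whole space.\<close>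

lemma nn_integral_lines:
  fixes f :: "'a::euclidean_space \<Rightarrow> ennreal"
  assumes f [measurable]: "f \<in> borel_measurable borel" and e: "e \<bullet> e = 1"
  shows "(\<integral>\<^sup>+x. f x \<partial>lborel) =
    (\<integral>\<^sup>+x. indicator {x. 0 \<le> x \<bullet> e \<and> x \<bullet> e < 1} x * (\<integral>\<^sup>+s. f (line_pt e x s) \<partial>lborel) \<partial>lborel)"
proof -
  define I :: "real \<Rightarrow> ennreal" where "I = indicator {0..<1}"
  have [measurable]: "I \<in> borel_measurable borel" unfolding I_def by measurable
  have ind: "indicator {x. 0 \<le> x \<bullet> e \<and> x \<bullet> e < 1} x = I (x \<bullet> e)" for x
    by (auto simp: I_def indicator_def)
  have "(\<integral>\<^sup>+x. I (x \<bullet> e) * (\<integral>\<^sup>+s. f (line_pt e x s) \<partial>lborel) \<partial>lborel)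
    = (\<integral>\<^sup>+x. I (x \<bullet> e) * (\<integral>\<^sup>+s. f (x + s *\<^sub>R e) \<partial>lborel) \<partial>lborel)"
  proof (rule nn_integral_cong, rule arg_cong2[where f = "(*)", OF refl])
    fix x
    have "(\<integral>\<^sup>+s. f (line_pt e x s) \<partial>lborel) = (\<integral>\<^sup>+s. (\<lambda>s. f (x + s *\<^sub>R e)) (- (x \<bullet> e) + s) \<partial>lborel)"
      by (simp add: line_pt_def)
    also have "\<dots> = (\<integral>\<^sup>+s. f (x + s *\<^sub>R e) \<partial>lborel)"
      by (rule nn_integral_lborel_shift) measurable
    finally show "(\<integral>\<^sup>+s. f (line_pt e x s) \<partial>lborel) = (\<integral>\<^sup>+s. f (x + s *\<^sub>R e) \<partial>lborel)" .
  qed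
  also have "\<dots> = (\<integral>\<^sup>+x. \<integral>\<^sup>+s. I (x \<bullet> e) * f (x + s *\<^sub>R e) \<partial>lborel \<partial>lborel)"
    by (intro nn_integral_cong nn_integral_cmult[symmetric]) measurable
  also have "\<dots> = (\<integral>\<^sup>+s. \<integral>\<^sup>+x. I (x \<bullet> e) * f (x + s *\<^sub>R e) \<partial>lborel \<partial>lborel)"
    by (rule lborel_pair.Fubini') measurable
  \<comment> \<open>Translating \<open>x\<close> by \<open>s\<close> times \<open>e\<close> moves
    the slab instead of \<open>f\<close>; integrating over \<open>s\<close> then leaves the length
    of the slab, which is 1.\<close>
  also have "\<dots> = (\<integral>\<^sup>+s. \<integral>\<^sup>+x. I (x \<bullet> e - s) * f x \<partial>lborel \<partial>lborel)"
  proof (rule nn_integral_cong)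
    fix s
    have "(\<integral>\<^sup>+x. I (x \<bullet> e) * f (x + s *\<^sub>R e) \<partial>lborel)
       = (\<integral>\<^sup>+x. (\<lambda>x. I (x \<bullet> e - s) * f x) (s *\<^sub>R e + x) \<partial>lborel)"
      using e by (simp add: inner_add_left add.commute)
    also have "\<dots> = (\<integral>\<^sup>+x. I (x \<bullet> e - s) * f x \<partial>lborel)"
      by (rule nn_integral_lborel_shift) measurable
    finally show "(\<integral>\<^sup>+x. I (x \<bullet> e) * f (x + s *\<^sub>R e) \<partial>lborel) = (\<integral>\<^sup>+x. I (x \<bullet> e - s) * f x \<partial>lborel)" .
  qed
  also have "\<dots> = (\<integral>\<^sup>+x. \<integral>\<^sup>+s. I (x \<bullet> e - s) * f x \<partial>lborel \<partial>lborel)"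
    by (rule lborel_pair.Fubini') measurable
  also have "\<dots> = (\<integral>\<^sup>+x. f x \<partial>lborel)"
  proof (rule nn_integral_cong)
    fix x
    have "(\<integral>\<^sup>+s. I (x \<bullet> e - s) * f x \<partial>lborel) = (\<integral>\<^sup>+s. I (x \<bullet> e - s) \<partial>lborel) * f x"
      by (rule nn_integral_multc) measurable
    also have "(\<integral>\<^sup>+s. I (x \<bullet> e - s) \<partial>lborel) = (\<integral>\<^sup>+s. indicator {x \<bullet> e - 1<..x \<bullet> e} s \<partial>lborel)"
      by (intro nn_integral_cong) (auto simp: I_def indicator_def)
    also have "\<dots> = 1" by simp
    finally show "(\<integral>\<^sup>+s. I (x \<bullet> e - s) * f x \<partial>lborel) = f x" by simp
  qed
  finally show ?thesis by (simp only: ind)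
qed

text \<open>For arbitrary \<open>h\<close> one direction survives: simple functions below
  \<open>h\<close> satisfy the equality, and the inner lower integrals grow with the integrand. This
  direction bounds the error from above.\<close>

lemma nn_integral_lines_le:
  fixes h :: "'a::euclidean_space \<Rightarrow> ennreal"
  assumes e: "e \<bullet> e = 1"
  shows "(\<integral>\<^sup>+x. h x \<partial>lborel) \<le>
    (\<integral>\<^sup>+x. indicator {x. 0 \<le> x \<bullet> e \<and> x \<bullet> e < 1} x * (\<integral>\<^sup>+s. h (line_pt e x s) \<partial>lborel) \<partial>lborel)"
  unfolding nn_integral_def[of lborel h]
proof (rule SUP_least)
  fix g :: "'a \<Rightarrow> ennreal"
  assume "g \<in> {g. simple_function lborel g \<and> g \<le> h}"
  then have g: "simple_function lborel g" "g \<le> h" by auto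
  then have "integral\<^sup>S lborel g = (\<integral>\<^sup>+x. g x \<partial>lborel)" by (simp add: nn_integral_eq_simple_integral)
  also have "\<dots> = (\<integral>\<^sup>+x. indicator {x. 0 \<le> x \<bullet> e \<and> x \<bullet> e < 1} x * (\<integral>\<^sup>+s. g (line_pt e x s) \<partial>lborel) \<partial>lborel)"
    using borel_measurable_simple_function[OF g(1)] by (intro nn_integral_lines e) simp
  also have "\<dots> \<le> (\<integral>\<^sup>+x. indicator {x. 0 \<le> x \<bullet> e \<and> x \<bullet> e < 1} x * (\<integral>\<^sup>+s. h (line_pt e x s) \<partial>lborel) \<partial>lborel)"
    using g(2) by (intro nn_integral_mono mult_left_mono) (auto simp: le_fun_def)
  finally show "integral\<^sup>S lborel g \<le> \<dots>" .
qed

text \<open>Integration along lines, applied to the indicator of a Borel null set that contains the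
  exceptional points.\<close>

lemma AE_lines:
  fixes P :: "'a::euclidean_space \<Rightarrow> bool"
  assumes P: "AE x in lborel. P x" and e: "e \<bullet> e = 1"
  shows "AE x in lborel. 0 \<le> x \<bullet> e \<and> x \<bullet> e < 1 \<longrightarrow> (AE s in lborel. P (line_pt e x s))"
proof -
  obtain N where N: "N \<in> null_sets lborel" "{x \<in> space lborel. \<not> P x} \<subseteq> N"
    using P by (rule AE_E) (auto simp: null_sets_def)
  then have [measurable]: "N \<in> sets borel" by auto
  note measurable_line_pt[measurable]
  let ?S = "{x. 0 \<le> x \<bullet> e \<and> x \<bullet> e < 1}"
  have m: "(\<lambda>x. indicator ?S x * (\<integral>\<^sup>+s. indicator N (line_pt e x s) \<partial>lborel) :: ennreal) \<in> borel_measurable lborel"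
    unfolding line_pt_def by measurable
  have "(\<integral>\<^sup>+x. indicator ?S x * (\<integral>\<^sup>+s. indicator N (line_pt e x s) \<partial>lborel) \<partial>lborel) = (\<integral>\<^sup>+x. indicator N x \<partial>lborel)"
    by (rule nn_integral_lines[OF _ e, symmetric]) measurable
  also have "\<dots> = 0" using N(1) by auto
  finally have "AE x in lborel. indicator ?S x * (\<integral>\<^sup>+s. indicator N (line_pt e x s) \<partial>lborel) = (0::ennreal)"
    using nn_integral_0_iff_AE[OF m] by simp
  then show ?thesis
  proof eventually_elim
    case (elim x)
    show ?case
    proof
      assume "0 \<le> x \<bullet> e \<and> x \<bullet> e < 1"
      then have "(\<integral>\<^sup>+s. indicator N (line_pt e x s) \<partial>lborel) = (0::ennreal)" using elim by simp
      then have "AE s in lborel. indicator N (line_pt e x s) = (0::ennreal)"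
        by (subst (asm) nn_integral_0_iff_AE) auto
      then show "AE s in lborel. P (line_pt e x s)"
        by eventually_elim (use N(2) in \<open>auto simp: indicator_def split: if_splits\<close>)
    qed
  qed
qed

section \<open>Polarizations and the rearrangement restricted to a line\<close>

lemma inner_line_pt: "e \<bullet> e = 1 \<Longrightarrow> line_pt e x s \<bullet> e = s"
  by (simp add: line_pt_def inner_add_left)

lemma hyp_reflect_line_pt:
  assumes e: "e \<bullet> e = 1"
  shows "hyp_reflect (e, b) (line_pt e x s) = line_pt e x (hyp_reflect (1, b) s)"
proof -
  have "hyp_reflect (e, b) (line_pt e x s) = line_pt e x s - (2 * (s - b)) *\<^sub>R e"
    using e by (simp add: hyp_reflect_def inner_line_pt)
  also have "\<dots> = line_pt e x (2 * b - s)"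
    by (simp add: line_pt_def algebra_simps flip: scaleR_2)
  finally show ?thesis by (simp add: hyp_reflect_real)
qed

lemma polar_fun_line_pt:
  assumes e: "e \<bullet> e = 1"
  shows "polar_fun (e, b) f (line_pt e x s) = polar_fun (1, b) (\<lambda>s. f (line_pt e x s)) s"
  using hyp_reflect_line_pt[OF e] inner_line_pt[OF e] by (simp add: polar_fun_def)

lemma polar_comp_fun_line_pt:
  assumes e: "e \<bullet> e = 1"
  shows "polar_comp_fun (polar_seq e b n) f (line_pt e x s) = polar_comp_fun (polar_seq 1 b n) (\<lambda>s. f (line_pt e x s)) s"
  by (induction n arbitrary: s) (simp_all add: polar_fun_line_pt[OF e])

lemma line_pt_line_pt:
  assumes e: "e \<bullet> e = 1"
  shows "line_pt e x s - s *\<^sub>R e + s' *\<^sub>R e = line_pt e x s'"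
  by (simp add: line_pt_def algebra_simps)

lemma solynin_set_line_pt:
  assumes u: "u \<noteq> 0"
  defines "e \<equiv> (1 / norm u) *\<^sub>R u"
  shows "line_pt e x s \<in> solynin_set (u, c) A \<longleftrightarrow> s \<in> solynin_set (1, c / norm u) {s. line_pt e x s \<in> A}"
proof -
  have e: "e \<bullet> e = 1" using u by (simp add: e_def dot_square_norm power2_eq_square)
  show ?thesis
    unfolding solynin_set_real
    using line_pt_line_pt[OF e] inner_line_pt[OF e]
    by (simp add: solynin_set_def Let_def e_def[symmetric])
qed

lemma solynin_fun_line_pt:
  assumes u: "u \<noteq> 0"
  defines "e \<equiv> (1 / norm u) *\<^sub>R u"
  shows "solynin_fun (u, c) f (line_pt e x s) = solynin_fun (1, c / norm u) (\<lambda>s. f (line_pt e x s)) s"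
  using solynin_set_line_pt[OF u] by (simp add: solynin_fun_def e_def)

text \<open>A Lebesgue measurable function may restrict badly to individual lines. On almost every
  line in the slab it agrees almost everywhere with the restriction of a Borel version, and
  completeness then gives measurability.\<close>

lemma measurable_lebesgue_AE_eq:
  fixes f g :: "'a::euclidean_space \<Rightarrow> real"
  assumes g: "g \<in> borel_measurable borel" and eq: "AE x in lborel. f x = g x"
  shows "f \<in> borel_measurable lebesgue"
proof -
  have "{x. a < f x} \<in> sets lebesgue" for a
  proof (rule completion.in_sets_AE)
    show "{x. a < g x} \<in> sets lebesgue"
      using borel_measurable_less[OF measurable_const g, of a] by (auto simp: pred_def)
    show "AE x in lebesgue. x \<in> {x. a < g x} \<longleftrightarrow> x \<in> {x. a < f x}"
      using AE_completion[OF eq] by eventually_elim simp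
  qed simp
  then show ?thesis by (simp add: borel_measurable_iff_greater)
qed

lemma nn_integral_error_tendsto:
  fixes u :: "'a::euclidean_space" and f :: "'a \<Rightarrow> real" and c :: real
  assumes u: "u \<noteq> 0" and p: "1 \<le> p" and f: "f \<in> Lp_plus p"
  defines "e \<equiv> (1 / norm u) *\<^sub>R u" and "t \<equiv> c / norm u"
  shows "(\<lambda>k. \<integral>\<^sup>+x. ennreal (\<bar>polar_comp_fun (polar_seq e (grid t k) (k * k)) f x - solynin_fun (u, c) f x\<bar> powr p) \<partial>lebesgue)
    \<longlonglongrightarrow> 0"
proof -
  have e: "e \<bullet> e = 1" using u by (simp add: e_def dot_square_norm power2_eq_square)
  have fM: "f \<in> borel_measurable lebesgue" and f0: "\<And>x. 0 \<le> f x"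
    and ffin: "(\<integral>\<^sup>+x. ennreal (\<bar>f x\<bar> powr p) \<partial>lebesgue) < \<infinity>"
    using f by (auto simp: Lp_plus_def)
  obtain g where g [measurable]: "g \<in> borel_measurable lborel" and fg: "AE x in lborel. f x = g x"
    using completion_ex_borel_measurable_real[OF fM] by auto
  let ?S = "{x. 0 \<le> x \<bullet> e \<and> x \<bullet> e < 1}"
  \<comment> \<open>Built from the Borel version \<open>g\<close> so that it is measurable in
    \<open>x\<close>. It is finite for almost every \<open>x\<close> in the slab, and
    \<open>2 * D x\<close> dominates the error on the line through \<open>x\<close>.\<close>
  define D where "D x = (\<integral>\<^sup>+s. ennreal (\<bar>g (line_pt e x s)\<bar> powr p) \<partial>lborel)" for x
  have D [measurable]: "D \<in> borel_measurable lborel"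
    unfolding D_def line_pt_def by measurable
  have S [measurable]: "?S \<in> sets borel" by measurable
  have "(\<integral>\<^sup>+x. indicator ?S x * D x \<partial>lborel) = (\<integral>\<^sup>+x. ennreal (\<bar>g x\<bar> powr p) \<partial>lborel)"
    unfolding D_def by (rule nn_integral_lines[OF _ e, symmetric]) measurable
  also have "\<dots> = (\<integral>\<^sup>+x. ennreal (\<bar>f x\<bar> powr p) \<partial>lborel)"
    by (rule nn_integral_cong_AE) (use fg in eventually_elim, simp)
  also have "\<dots> < \<infinity>" using ffin by (simp only: nn_integral_completion)
  finally have Dfin: "(\<integral>\<^sup>+x. indicator ?S x * D x \<partial>lborel) < \<infinity>" .
  have DAE: "AE x in lborel. indicator ?S x * D x \<noteq> \<infinity>"
    using Dfin by (intro nn_integral_PInf_AE) auto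
  define h where "h k x = ennreal (\<bar>polar_comp_fun (polar_seq e (grid t k) (k * k)) f x - solynin_fun (u, c) f x\<bar> powr p)" for k x
  have line: "AE x in lborel. x \<in> ?S \<longrightarrow>
      (\<lambda>k. \<integral>\<^sup>+s. h k (line_pt e x s) \<partial>lborel) \<longlonglongrightarrow> 0 \<and> (\<forall>k. (\<integral>\<^sup>+s. h k (line_pt e x s) \<partial>lborel) \<le> 2 * D x)"
    using AE_lines[OF fg e] DAE
  proof eventually_elim
    case (elim x)
    show ?case
    proof
      assume x: "x \<in> ?S"
      define F where "F s = f (line_pt e x s)" for s
      have eq: "AE s in lborel. F s = g (line_pt e x s)" using elim(1) x by (simp add: F_def)
      have F: "F \<in> borel_measurable lebesgue"
      proof (rule measurable_lebesgue_AE_eq[OF _ eq])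
        show "(\<lambda>s. g (line_pt e x s)) \<in> borel_measurable borel"
          unfolding line_pt_def by measurable
      qed
      have F0: "0 \<le> F s" for s by (simp add: F_def f0)
      have "(\<integral>\<^sup>+s. ennreal (F s powr p) \<partial>lborel) = D x"
        unfolding D_def by (rule nn_integral_cong_AE) (use eq in eventually_elim, use F0 in \<open>metis abs_of_nonneg\<close>)
      then have FD: "(\<integral>\<^sup>+s. ennreal (F s powr p) \<partial>lebesgue) = D x" by (simp only: nn_integral_completion)
      moreover have "D x < \<infinity>" using elim(2) x by (auto simp: top.not_eq_extremum)
      ultimately have fin: "(\<integral>\<^sup>+s. ennreal (F s powr p) \<partial>lebesgue) < \<infinity>" by simp
      have h: "(\<integral>\<^sup>+s. h k (line_pt e x s) \<partial>lborel) =
          (\<integral>\<^sup>+s. ennreal (\<bar>polar_comp_fun (polar_seq 1 (grid t k) (k * k)) F s - solynin_fun (1, t) F s\<bar> powr p) \<partial>lebesgue)" for k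
        unfolding h_def polar_comp_fun_line_pt[OF e] F_def nn_integral_completion t_def
        by (simp only: solynin_fun_line_pt[OF u, folded e_def])
      show "(\<lambda>k. \<integral>\<^sup>+s. h k (line_pt e x s) \<partial>lborel) \<longlonglongrightarrow> 0 \<and> (\<forall>k. (\<integral>\<^sup>+s. h k (line_pt e x s) \<partial>lborel) \<le> 2 * D x)"
        unfolding h
        using line_error_tendsto[OF F F0 p fin] line_error_bound[OF F F0 p fin] unfolding FD by blast
    qed
  qed
  have "(\<lambda>k. \<integral>\<^sup>+x. indicator ?S x * (\<integral>\<^sup>+s. h k (line_pt e x s) \<partial>lborel) \<partial>lborel) \<longlonglongrightarrow> 0"
  proof (rule nn_integral_tendsto_0_dominated)
    show "(\<lambda>x. 2 * (indicator ?S x * D x)) \<in> borel_measurable lborel" by measurable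
    show "(\<integral>\<^sup>+x. 2 * (indicator ?S x * D x) \<partial>lborel) < \<infinity>"
      using Dfin by (subst nn_integral_cmult) (auto simp: ennreal_mult_less_top)
    show "AE x in lborel. \<forall>k. indicator ?S x * (\<integral>\<^sup>+s. h k (line_pt e x s) \<partial>lborel) \<le> 2 * (indicator ?S x * D x)"
      using line by eventually_elim (auto simp: indicator_def)
    show "AE x in lborel. (\<lambda>k. indicator ?S x * (\<integral>\<^sup>+s. h k (line_pt e x s) \<partial>lborel)) \<longlonglongrightarrow> 0"
      using line by eventually_elim (auto simp: indicator_def)
  qed
  then have "(\<lambda>k. \<integral>\<^sup>+x. h k x \<partial>lborel) \<longlonglongrightarrow> 0"
    by (rule tendsto_sandwich[OF _ _ tendsto_const, rotated 2])
       (auto intro!: always_eventually nn_integral_lines_le[OF e])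
  then show ?thesis by (simp only: nn_integral_completion h_def)
qed

lemma Lp_norm_tendsto_0:
  assumes p: "0 < p" and lim: "(\<lambda>k. \<integral>\<^sup>+x. ennreal (\<bar>g k x\<bar> powr p) \<partial>lebesgue) \<longlonglongrightarrow> 0"
  shows "(\<lambda>k. Lp_norm p (g k)) \<longlonglongrightarrow> 0"
proof -
  define I where "I k = (\<integral>\<^sup>+x. ennreal (\<bar>g k x\<bar> powr p) \<partial>lebesgue)" for k
  have I: "I \<longlonglongrightarrow> 0" using lim by (simp add: I_def[abs_def])
  have "(\<lambda>k. enn2real (I k)) \<longlonglongrightarrow> enn2real 0" by (rule tendsto_enn2real) (use I in auto)
  then have "(\<lambda>k. enn2real (I k) powr (1 / p)) \<longlonglongrightarrow> 0 powr (1 / p)"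
    using p by (intro tendsto_powr') auto
  then have "(\<lambda>k. ennreal (enn2real (I k) powr (1 / p))) \<longlonglongrightarrow> 0"
    using tendsto_ennrealI by fastforce
  \<comment> \<open>Convergence to 0 makes the integrals eventually finite, so the infinite branch
    of \<open>Lp_norm\<close> does not affect the limit.\<close>
  moreover have "\<forall>\<^sub>F k in sequentially. I k < \<infinity>" using order_tendstoD(2)[OF I, of \<infinity>] by simp
  then have "\<forall>\<^sub>F k in sequentially. ennreal (enn2real (I k) powr (1 / p)) = Lp_norm p (g k)"
    by eventually_elim (auto simp: Lp_norm_def I_def[symmetric] Let_def)
  ultimately show ?thesis by (rule Lim_transform_eventually)
qed

lemma polar_seq_normal: "G \<in> set (polar_seq v b n) \<Longrightarrow> fst G = v"
  by (induction n) auto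

lemma AE_not_in_hyperplane:
  fixes u :: "'a::euclidean_space"
  assumes "u \<noteq> 0"
  shows "AE x in lebesgue. x \<bullet> u \<noteq> c"
proof -
  have "{x. u \<bullet> x = c} \<in> null_sets lebesgue"
    using negligible_hyperplane[of u c] assms by (simp add: negligible_iff_null_sets)
  then show ?thesis by (rule AE_I') (auto simp: inner_commute)
qed

text \<open>Off the hyperplane the rearrangement of an indicator is the indicator of the rearranged set;
  on it every level set contributes, so the supremum is over an unbounded set.\<close>

lemma solynin_fun_indicator:
  fixes u :: "'a::euclidean_space"
  assumes u: "u \<noteq> 0" and x: "x \<bullet> u \<noteq> c"
  shows "solynin_fun (u, c) (indicator A) x = indicator (solynin_set (u, c) A) x"
proof -
  define e where "e = (1 / norm u) *\<^sub>R u"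
  define t where "t = c / norm u"
  have xt: "x \<bullet> e \<noteq> t" using u x by (simp add: e_def t_def field_simps)
  \<comment> \<open>Levels from 1 upwards have an empty superlevel set, whose image is not empty:
    the interval of radius 0 leaves the hyperplane, which \<open>x\<close> avoids.\<close>
  have "solynin1 t {} = {t}"
  proof -
    have "push_end {} t = t"
      using push_end[of "{}" t] by (simp add: mass_def)
    then show ?thesis using push_push_end[of "{}" t] by (simp add: solynin1_eq_push)
  qed
  then have empty: "x \<notin> solynin_set (u, c) {}"
    using xt by (simp add: solynin_set_def Let_def e_def t_def)
  have "{s::real. 0 < s \<and> x \<in> solynin_set (u, c) {y. s < indicator A y}} =
      (if x \<in> solynin_set (u, c) A then {0<..<1} else {})"
  proof -
    have "{y. s < indicator A y} = (if s < 1 then A else {})" if "0 < s" for s :: real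
      using that by (auto simp: indicator_def)
    then show ?thesis using empty by (auto split: if_splits)
  qed
  moreover have "Sup ({0} \<union> {0<..<1::real}) = 1"
  proof -
    have "{0} \<union> {0<..<1} = {0..<1::real}" by auto
    then show ?thesis by simp
  qed
  ultimately show ?thesis by (simp add: solynin_fun_def)
qed

lemma polar_comp_fun_indicator:
  "polar_comp_fun Hs (indicator A) x = (indicator (polar_comp_set Hs A) x :: real)"
proof (induction Hs arbitrary: x)
  case (Cons H Hs)
  have "hyp_reflect H x = x" if "x \<bullet> fst H = snd H" using that by (simp add: hyp_reflect_def)
  then show ?case
    unfolding polar_comp_fun_simps polar_comp_set_simps polar_fun_def Cons.IH
    by (auto simp: polar_set_def indicator_def)
qed simp

theorem theorem8p4:
  fixes u :: "'a::euclidean_space" and c p :: real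
  assumes "u \<noteq> 0" and "1 \<le> p"
  shows "(\<exists>Hs :: nat \<Rightarrow> ('a \<times> real) list.
            (\<forall>k. \<forall>G \<in> set (Hs k). fst G \<noteq> 0) \<and>
            (\<forall>f \<in> Lp_plus p.
               (\<lambda>k. Lp_norm p (\<lambda>x. polar_comp_fun (Hs k) f x - solynin_fun (u, c) f x))
                 \<longlonglongrightarrow> 0))
       \<and> (\<exists>Hs :: nat \<Rightarrow> ('a \<times> real) list.
            (\<forall>k. \<forall>G \<in> set (Hs k). fst G \<noteq> 0) \<and>
            (\<forall>A. A \<in> sets lebesgue \<and> emeasure lebesgue A < \<infinity> \<longrightarrow>
               (\<lambda>k. Lp_norm 1 (\<lambda>x. indicator (polar_comp_set (Hs k) A) x
                                    - indicator (solynin_set (u, c) A) x))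
                 \<longlonglongrightarrow> 0))"
proof -
  define e where "e = (1 / norm u) *\<^sub>R u"
  \<comment> \<open>Depends on \<open>u\<close>, \<open>c\<close> and \<open>k\<close> only, so one
    sequence serves both claims; the one for sets is the case of exponent 1 applied to
    indicators.\<close>
  define Hs where "Hs k = polar_seq e (grid (c / norm u) k) (k * k)" for k
  have Hs: "\<forall>k. \<forall>G \<in> set (Hs k). fst G \<noteq> 0"
  proof (intro allI ballI)
    fix k G assume "G \<in> set (Hs k)"
    then have "fst G = e" unfolding Hs_def by (rule polar_seq_normal)
    then show "fst G \<noteq> 0" using assms(1) by (simp add: e_def)
  qed
  have fun_lim: "(\<lambda>k. \<integral>\<^sup>+x. ennreal (\<bar>polar_comp_fun (Hs k) f x - solynin_fun (u, c) f x\<bar> powr q) \<partial>lebesgue) \<longlonglongrightarrow> 0"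
    if "f \<in> Lp_plus q" "1 \<le> q" for f q
    using nn_integral_error_tendsto[OF assms(1) that(2,1), of c] unfolding Hs_def e_def .
  have "(\<lambda>k. Lp_norm 1 (\<lambda>x. indicator (polar_comp_set (Hs k) A) x - indicator (solynin_set (u, c) A) x)) \<longlonglongrightarrow> 0"
    if A: "A \<in> sets lebesgue" "emeasure lebesgue A < \<infinity>" for A
  proof (rule Lp_norm_tendsto_0)
    have "(\<integral>\<^sup>+x. ennreal (\<bar>indicator A x\<bar> powr 1) \<partial>lebesgue) = (\<integral>\<^sup>+x. indicator A x \<partial>lebesgue)"
      by (intro nn_integral_cong) (auto simp: indicator_def)
    also have "\<dots> < \<infinity>" using A by simp
    finally have "indicator A \<in> Lp_plus 1"
      using A(1) by (simp add: Lp_plus_def)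
    then have "(\<lambda>k. \<integral>\<^sup>+x. ennreal (\<bar>polar_comp_fun (Hs k) (indicator A) x - solynin_fun (u, c) (indicator A) x\<bar> powr 1) \<partial>lebesgue) \<longlonglongrightarrow> 0"
      by (rule fun_lim) simp
    moreover have "(\<integral>\<^sup>+x. ennreal (\<bar>polar_comp_fun (Hs k) (indicator A) x - solynin_fun (u, c) (indicator A) x\<bar> powr 1) \<partial>lebesgue)
        = (\<integral>\<^sup>+x. ennreal (\<bar>indicator (polar_comp_set (Hs k) A) x - indicator (solynin_set (u, c) A) x\<bar> powr 1) \<partial>lebesgue)" for k
      by (rule nn_integral_cong_AE)
         (use AE_not_in_hyperplane[OF assms(1), of c] in eventually_elim,
          simp add: polar_comp_fun_indicator solynin_fun_indicator[OF assms(1)])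
    ultimately show "(\<lambda>k. \<integral>\<^sup>+x. ennreal (\<bar>indicator (polar_comp_set (Hs k) A) x - indicator (solynin_set (u, c) A) x\<bar> powr 1) \<partial>lebesgue) \<longlonglongrightarrow> 0"
      by (simp only:)
  qed simp
  moreover have "\<forall>f \<in> Lp_plus p.
      (\<lambda>k. Lp_norm p (\<lambda>x. polar_comp_fun (Hs k) f x - solynin_fun (u, c) f x)) \<longlonglongrightarrow> 0"
    using fun_lim[OF _ assms(2)] assms(2) by (auto intro!: Lp_norm_tendsto_0)
  ultimately show ?thesis using Hs by blast
qed

end
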